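(* Let $k\ge 1$ and $n\geq 1$ be integers and let $F_{\mathcal{C}_k}(n)$ be the free $\mathcal{C}_k$-algebra with $n$ generators. Then $$|F_{\mathcal{C}_k}(n)|= \prod_{d\mid k} (2^d)^{\alpha_{2,d}} \cdot \prod_{d\mid k} (3^d)^{\alpha_{3,d}} \cdot \prod_{d\mid k} (4^d)^{\alpha_{4,d}},$$ where $$\alpha_{2,d}=\frac{ (2^d)^n -\sum_{\emptyset\neq Z\subseteq M(d)} (-1)^{|Z|-1} (2^{\gcd(Z)})^n}{d},$$ $$\alpha_{3,d} = \frac{ (3^d)^n - (2^d)^n - \sum_{\emptyset\neq W\subseteq M(d)} (-1)^{|W|-1} (3^{\gcd(W)})^n + \sum_{\emptyset\neq H\subseteq M(d)\times M(d)} (-1)^{|H|-1} (2^{\gcd(H_1\cup H_2)})^n }{d},$$ $$\alpha_{4,d} = \frac{ (4^d)^n - \sum_{\emptyset\neq W\subseteq M(d)} (-1)^{|W|-1} (4^{\gcd(W)})^n - (2^{d})^n + \sum_{\emptyset\neq H\subseteq M(d)\times M(d)} (-1)^{|H|-1} (2^{\gcd(H_1\cup H_2)})^n }{2d}.$$ Here $M(d)$ is the set of maximal divisors of $d$ different from $d$, and for $H\subseteq M(d)\times M(d)$ one puts $H_1=\{x:(x,y)\in H\}$ and $H_2=\{y:(x,y)\in H\}$.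
   Context: A De Morgan algebra is a bounded distributive lattice $\langle A,\wedge,\vee,0,1\rangle$ with a unary operation $\sim$ satisfying $\sim\sim x=x$ and $\sim(x\wedge y)=\sim x\vee\sim y$. An $mpM$-algebra (modal pseudocomplemented De Morgan algebra) is a De Morgan algebra with a unary operation ${}^\ast$ satisfying $x\wedge(x\wedge y)^\ast=x\wedge y^\ast$, $x\wedge 0^\ast=x$, $0^{\ast\ast}=0$ and $x\vee\sim x\le x\vee x^\ast$. A $k$-cyclic $mpM$-algebra ($\mathcal{C}_k$-algebra) is a pair $(A,t)$ with $A$ an $mpM$-algebra and $t:A\to A$ an automorphism of the $mpM$-algebra $A$ such that $t^k(x)=x$ for all $x\in A$. The class of $\mathcal{C}_k$-algebras is a variety (in the signature $\wedge,\vee,\sim,{}^\ast,t,0,1$). The elements of $M(d)$ are the divisors $x\neq d$ of $d$ that are maximal, under divisibility, among the divisors of $d$ different from $d$; $M(1)=\emptyset$, and empty sums are $0$. $\gcd(Z)$ is the greatest common divisor of the elements of $Z$. *)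

theory Defs
  imports Complex_Main
begin

record 'a mpM_struct =
  carrier :: "'a set"
  meet :: "'a \<Rightarrow> 'a \<Rightarrow> 'a" (infixl "\<sqinter>\<index>" 70)
  join :: "'a \<Rightarrow> 'a \<Rightarrow> 'a" (infixl "\<squnion>\<index>" 65)
  dneg :: "'a \<Rightarrow> 'a" ("\<sim>\<index> _" [81] 80)
  star :: "'a \<Rightarrow> 'a" ("_\<star>\<index>" [999] 999)
  lzero :: "'a" ("\<zero>\<index>")
  lone :: "'a" ("\<one>\<index>")

locale de_morgan_algebra =
  fixes A :: "'a mpM_struct" (structure)
  assumes meet_closed: "x \<in> carrier A \<Longrightarrow> y \<in> carrier A \<Longrightarrow> x \<sqinter> y \<in> carrier A"
    and join_closed: "x \<in> carrier A \<Longrightarrow> y \<in> carrier A \<Longrightarrow> x \<squnion> y \<in> carrier A"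
    and dneg_closed: "x \<in> carrier A \<Longrightarrow> \<sim> x \<in> carrier A"
    and zero_closed: "\<zero> \<in> carrier A"
    and one_closed: "\<one> \<in> carrier A"
    and meet_commute: "x \<in> carrier A \<Longrightarrow> y \<in> carrier A \<Longrightarrow> x \<sqinter> y = y \<sqinter> x"
    and join_commute: "x \<in> carrier A \<Longrightarrow> y \<in> carrier A \<Longrightarrow> x \<squnion> y = y \<squnion> x"
    and meet_assoc: "x \<in> carrier A \<Longrightarrow> y \<in> carrier A \<Longrightarrow> z \<in> carrier A \<Longrightarrow>
          (x \<sqinter> y) \<sqinter> z = x \<sqinter> (y \<sqinter> z)"
    and join_assoc: "x \<in> carrier A \<Longrightarrow> y \<in> carrier A \<Longrightarrow> z \<in> carrier A \<Longrightarrow>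
          (x \<squnion> y) \<squnion> z = x \<squnion> (y \<squnion> z)"
    and meet_absorb: "x \<in> carrier A \<Longrightarrow> y \<in> carrier A \<Longrightarrow> x \<sqinter> (x \<squnion> y) = x"
    and join_absorb: "x \<in> carrier A \<Longrightarrow> y \<in> carrier A \<Longrightarrow> x \<squnion> (x \<sqinter> y) = x"
    and distrib: "x \<in> carrier A \<Longrightarrow> y \<in> carrier A \<Longrightarrow> z \<in> carrier A \<Longrightarrow>
          x \<sqinter> (y \<squnion> z) = (x \<sqinter> y) \<squnion> (x \<sqinter> z)"
    and meet_zero: "x \<in> carrier A \<Longrightarrow> x \<sqinter> \<zero> = \<zero>"
    and join_one: "x \<in> carrier A \<Longrightarrow> x \<squnion> \<one> = \<one>"
    and dneg_dneg: "x \<in> carrier A \<Longrightarrow> \<sim> (\<sim> x) = x"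
    and dneg_meet: "x \<in> carrier A \<Longrightarrow> y \<in> carrier A \<Longrightarrow> \<sim> (x \<sqinter> y) = \<sim> x \<squnion> \<sim> y"

text \<open>In the last axiom \<open>x \<squnion> \<sim> x \<le> x \<squnion> x\<star>\<close>, the lattice order is
  written out as \<open>a \<sqinter> b = a\<close>.\<close>

locale mpM_algebra = de_morgan_algebra A for A :: "'a mpM_struct" (structure) +
  assumes star_closed: "x \<in> carrier A \<Longrightarrow> x\<star> \<in> carrier A"
    and meet_star_meet: "x \<in> carrier A \<Longrightarrow> y \<in> carrier A \<Longrightarrow>
          x \<sqinter> (x \<sqinter> y)\<star> = x \<sqinter> y\<star>"
    and meet_star_zero: "x \<in> carrier A \<Longrightarrow> x \<sqinter> \<zero>\<star> = x"
    and star_star_zero: "\<zero>\<star>\<star> = \<zero>"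
    and join_dneg_le_join_star: "x \<in> carrier A \<Longrightarrow>
          (x \<squnion> \<sim> x) \<sqinter> (x \<squnion> x\<star>) = x \<squnion> \<sim> x"

definition mpM_hom :: "'a mpM_struct \<Rightarrow> 'b mpM_struct \<Rightarrow> ('a \<Rightarrow> 'b) \<Rightarrow> bool" where
  "mpM_hom A B h \<longleftrightarrow>
     (\<forall>x\<in>carrier A. h x \<in> carrier B) \<and>
     (\<forall>x\<in>carrier A. \<forall>y\<in>carrier A. h (x \<sqinter>\<^bsub>A\<^esub> y) = h x \<sqinter>\<^bsub>B\<^esub> h y) \<and>
     (\<forall>x\<in>carrier A. \<forall>y\<in>carrier A. h (x \<squnion>\<^bsub>A\<^esub> y) = h x \<squnion>\<^bsub>B\<^esub> h y) \<and>
     (\<forall>x\<in>carrier A. h (\<sim>\<^bsub>A\<^esub> x) = \<sim>\<^bsub>B\<^esub> h x) \<and>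
     (\<forall>x\<in>carrier A. h (x\<star>\<^bsub>A\<^esub>) = (h x)\<star>\<^bsub>B\<^esub>) \<and>
     h \<zero>\<^bsub>A\<^esub> = \<zero>\<^bsub>B\<^esub> \<and> h \<one>\<^bsub>A\<^esub> = \<one>\<^bsub>B\<^esub>"

definition mpM_automorphism :: "'a mpM_struct \<Rightarrow> ('a \<Rightarrow> 'a) \<Rightarrow> bool" where
  "mpM_automorphism A t \<longleftrightarrow> mpM_hom A A t \<and> bij_betw t (carrier A) (carrier A)"

locale cyclic_mpM_algebra = mpM_algebra A for A :: "'a mpM_struct" (structure) +
  fixes k :: nat and t :: "'a \<Rightarrow> 'a"
  assumes automorphism: "mpM_automorphism A t"
    and cyclic: "x \<in> carrier A \<Longrightarrow> (t ^^ k) x = x"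

definition cyclic_mpM_hom ::
  "'a mpM_struct \<Rightarrow> ('a \<Rightarrow> 'a) \<Rightarrow> 'b mpM_struct \<Rightarrow> ('b \<Rightarrow> 'b) \<Rightarrow> ('a \<Rightarrow> 'b) \<Rightarrow> bool" where
  "cyclic_mpM_hom A t B u h \<longleftrightarrow> mpM_hom A B h \<and> (\<forall>x\<in>carrier A. h (t x) = u (h x))"


section \<open>The free algebra\<close>

text \<open>The free algebra on \<open>n\<close> generators is the algebra of terms in the variables
  \<open>0, \<dots>, n - 1\<close>, modulo the equations derivable from the axioms by equational logic.
  Its universal property, with respect to algebras over arbitrary types, is proved at the
  end of this section.\<close>

datatype (vars: 'v) trm =
    Var 'v
  | Meet "'v trm" "'v trm"
  | Join "'v trm" "'v trm"
  | Neg "'v trm"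
  | Star "'v trm"
  | Shift "'v trm"
  | Zero
  | One

text \<open>Since \<open>t ^ k = id\<close> with \<open>k \<ge> 1\<close> forces \<open>t\<close> to be bijective, the equations for
  \<open>Shift\<close> say exactly that it is an automorphism.\<close>

inductive Ck_eq :: "nat \<Rightarrow> 'v trm \<Rightarrow> 'v trm \<Rightarrow> bool" for k :: nat where
  refl: "Ck_eq k x x"
| sym: "Ck_eq k x y \<Longrightarrow> Ck_eq k y x"
| trans: "Ck_eq k x y \<Longrightarrow> Ck_eq k y z \<Longrightarrow> Ck_eq k x z"
| cong_Meet: "Ck_eq k x x' \<Longrightarrow> Ck_eq k y y' \<Longrightarrow> Ck_eq k (Meet x y) (Meet x' y')"
| cong_Join: "Ck_eq k x x' \<Longrightarrow> Ck_eq k y y' \<Longrightarrow> Ck_eq k (Join x y) (Join x' y')"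
| cong_Neg: "Ck_eq k x x' \<Longrightarrow> Ck_eq k (Neg x) (Neg x')"
| cong_Star: "Ck_eq k x x' \<Longrightarrow> Ck_eq k (Star x) (Star x')"
| cong_Shift: "Ck_eq k x x' \<Longrightarrow> Ck_eq k (Shift x) (Shift x')"
| meet_commute: "Ck_eq k (Meet x y) (Meet y x)"
| join_commute: "Ck_eq k (Join x y) (Join y x)"
| meet_assoc: "Ck_eq k (Meet (Meet x y) z) (Meet x (Meet y z))"
| join_assoc: "Ck_eq k (Join (Join x y) z) (Join x (Join y z))"
| meet_absorb: "Ck_eq k (Meet x (Join x y)) x"
| join_absorb: "Ck_eq k (Join x (Meet x y)) x"
| distrib: "Ck_eq k (Meet x (Join y z)) (Join (Meet x y) (Meet x z))"
| meet_zero: "Ck_eq k (Meet x Zero) Zero"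
| join_one: "Ck_eq k (Join x One) One"
| dneg_dneg: "Ck_eq k (Neg (Neg x)) x"
| dneg_meet: "Ck_eq k (Neg (Meet x y)) (Join (Neg x) (Neg y))"
| meet_star_meet: "Ck_eq k (Meet x (Star (Meet x y))) (Meet x (Star y))"
| meet_star_zero: "Ck_eq k (Meet x (Star Zero)) x"
| star_star_zero: "Ck_eq k (Star (Star Zero)) Zero"
| join_dneg_le_join_star:
    "Ck_eq k (Meet (Join x (Neg x)) (Join x (Star x))) (Join x (Neg x))"
| shift_meet: "Ck_eq k (Shift (Meet x y)) (Meet (Shift x) (Shift y))"
| shift_join: "Ck_eq k (Shift (Join x y)) (Join (Shift x) (Shift y))"
| shift_neg: "Ck_eq k (Shift (Neg x)) (Neg (Shift x))"
| shift_star: "Ck_eq k (Shift (Star x)) (Star (Shift x))"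
| shift_zero: "Ck_eq k (Shift Zero) Zero"
| shift_one: "Ck_eq k (Shift One) One"
| cyclic: "Ck_eq k ((Shift ^^ k) x) x"

definition trms :: "nat \<Rightarrow> nat trm set" where
  "trms n = {s. vars s \<subseteq> {..<n}}"

definition Ck_rel :: "nat \<Rightarrow> nat \<Rightarrow> nat trm rel" where
  "Ck_rel k n = {(x, y). x \<in> trms n \<and> y \<in> trms n \<and> Ck_eq k x y}"

definition free_Ck :: "nat \<Rightarrow> nat \<Rightarrow> nat trm set mpM_struct" where
  "free_Ck k n =
    \<lparr> carrier = trms n // Ck_rel k n,
      meet = (\<lambda>X Y. \<Union>x\<in>X. \<Union>y\<in>Y. Ck_rel k n `` {Meet x y}),
      join = (\<lambda>X Y. \<Union>x\<in>X. \<Union>y\<in>Y. Ck_rel k n `` {Join x y}),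
      dneg = (\<lambda>X. \<Union>x\<in>X. Ck_rel k n `` {Neg x}),
      star = (\<lambda>X. \<Union>x\<in>X. Ck_rel k n `` {Star x}),
      lzero = Ck_rel k n `` {Zero},
      lone = Ck_rel k n `` {One} \<rparr>"

definition free_shift :: "nat \<Rightarrow> nat \<Rightarrow> nat trm set \<Rightarrow> nat trm set" where
  "free_shift k n = (\<lambda>X. \<Union>x\<in>X. Ck_rel k n `` {Shift x})"

definition free_gen :: "nat \<Rightarrow> nat \<Rightarrow> nat \<Rightarrow> nat trm set" where
  "free_gen k n i = Ck_rel k n `` {Var i}"

lemma trms_simps [simp]:
  "Var i \<in> trms n \<longleftrightarrow> i < n"
  "Meet x y \<in> trms n \<longleftrightarrow> x \<in> trms n \<and> y \<in> trms n"
  "Join x y \<in> trms n \<longleftrightarrow> x \<in> trms n \<and> y \<in> trms n"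
  "Neg x \<in> trms n \<longleftrightarrow> x \<in> trms n"
  "Star x \<in> trms n \<longleftrightarrow> x \<in> trms n"
  "Shift x \<in> trms n \<longleftrightarrow> x \<in> trms n"
  "Zero \<in> trms n"
  "One \<in> trms n"
  by (auto simp: trms_def)

lemma equiv_Ck_rel: "equiv (trms n) (Ck_rel k n)"
  by (rule equivI)
    (auto simp: Ck_rel_def refl_on_def sym_def trans_def intro: Ck_eq.intros(1-3))

abbreviation cls :: "nat \<Rightarrow> nat \<Rightarrow> nat trm \<Rightarrow> nat trm set" where
  "cls k n x \<equiv> Ck_rel k n `` {x}"

lemma cls_eq_iff: "x \<in> trms n \<Longrightarrow> y \<in> trms n \<Longrightarrow> cls k n x = cls k n y \<longleftrightarrow> Ck_eq k x y"
  using eq_equiv_class_iff[OF equiv_Ck_rel, of x n y k] by (simp add: Ck_rel_def)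

lemma cls_eqI: "Ck_eq k x y \<Longrightarrow> x \<in> trms n \<Longrightarrow> y \<in> trms n \<Longrightarrow> cls k n x = cls k n y"
  by (simp add: cls_eq_iff)

lemma carrier_free_Ck: "carrier (free_Ck k n) = cls k n ` trms n"
  by (auto simp: free_Ck_def quotient_def)

lemma Union_cls:
  assumes "x \<in> trms n" "\<And>x'. x' \<in> trms n \<Longrightarrow> Ck_eq k x x' \<Longrightarrow> f x' = f x"
  shows "(\<Union>x'\<in>cls k n x. f x') = f x"
proof -
  have "x \<in> cls k n x" using assms(1) by (auto simp: Ck_rel_def intro: Ck_eq.refl)
  moreover have "f x' = f x" if "x' \<in> cls k n x" for x'
    using that assms by (auto simp: Ck_rel_def)
  ultimately show ?thesis by blast
qed

lemma Union_cls2: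
  assumes "x \<in> trms n" "y \<in> trms n"
    and "\<And>x' y'. x' \<in> trms n \<Longrightarrow> y' \<in> trms n \<Longrightarrow> Ck_eq k x x' \<Longrightarrow> Ck_eq k y y' \<Longrightarrow>
           f x' y' = f x y"
  shows "(\<Union>x'\<in>cls k n x. \<Union>y'\<in>cls k n y. f x' y') = f x y"
proof -
  have "(\<Union>y'\<in>cls k n y. f x' y') = f x y" if "x' \<in> trms n" "Ck_eq k x x'" for x'
    using assms that by (subst Union_cls) (metis Ck_eq.refl)+
  then show ?thesis
    using assms(1) by (subst Union_cls) (auto intro: Ck_eq.refl)
qed

lemma free_Ck_simps:
  "x \<in> trms n \<Longrightarrow> y \<in> trms n \<Longrightarrow>
     meet (free_Ck k n) (cls k n x) (cls k n y) = cls k n (Meet x y)"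
  "x \<in> trms n \<Longrightarrow> y \<in> trms n \<Longrightarrow>
     join (free_Ck k n) (cls k n x) (cls k n y) = cls k n (Join x y)"
  "x \<in> trms n \<Longrightarrow> dneg (free_Ck k n) (cls k n x) = cls k n (Neg x)"
  "x \<in> trms n \<Longrightarrow> star (free_Ck k n) (cls k n x) = cls k n (Star x)"
  "x \<in> trms n \<Longrightarrow> free_shift k n (cls k n x) = cls k n (Shift x)"
  "lzero (free_Ck k n) = cls k n Zero"
  "lone (free_Ck k n) = cls k n One"
  unfolding free_Ck_def free_shift_def mpM_struct.simps
  by (rule Union_cls2 Union_cls HOL.refl;
      simp add: cls_eq_iff Ck_eq.cong_Meet Ck_eq.cong_Join Ck_eq.cong_Neg Ck_eq.cong_Star
        Ck_eq.cong_Shift Ck_eq.sym)+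

lemma funpow_Shift_trms [simp]: "(Shift ^^ j) x \<in> trms n \<longleftrightarrow> x \<in> trms n"
  by (induction j) auto

lemma free_shift_funpow:
  "x \<in> trms n \<Longrightarrow> (free_shift k n ^^ j) (cls k n x) = cls k n ((Shift ^^ j) x)"
  by (induction j) (auto simp: free_Ck_simps)

theorem free_Ck_cyclic_mpM_algebra:
  assumes "k \<ge> 1"
  shows "cyclic_mpM_algebra (free_Ck k n) k (free_shift k n)"
proof -
  note [simp] = carrier_free_Ck free_Ck_simps cls_eq_iff
  let ?F = "free_Ck k n" and ?t = "free_shift k n"
  have cyc: "(?t ^^ k) x = x" if "x \<in> carrier ?F" for x
    using that unfolding carrier_free_Ck
    by (elim imageE) (simp add: free_shift_funpow Ck_eq.cyclic)
  have closed: "?t x \<in> carrier ?F" if "x \<in> carrier ?F" for x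
    using that by auto
  have closed': "(?t ^^ j) x \<in> carrier ?F" if "x \<in> carrier ?F" for x j
    by (induction j) (use that closed in \<open>auto simp del: carrier_free_Ck\<close>)
  have k: "k = Suc (k - 1)" using assms by simp
  have "bij_betw ?t (carrier ?F) (carrier ?F)"
  proof (rule bij_betw_byWitness[where f' = "?t ^^ (k - 1)"])
    show "\<forall>x\<in>carrier ?F. (?t ^^ (k - 1)) (?t x) = x"
      using cyc k by (metis comp_apply funpow_Suc_right)
    show "\<forall>x\<in>carrier ?F. ?t ((?t ^^ (k - 1)) x) = x"
      using cyc k by (metis comp_apply funpow.simps(2))
  qed (use closed closed' in \<open>blast+\<close>)
  moreover have "mpM_hom ?F ?F ?t"
    by (simp add: mpM_hom_def Ck_eq.intros(9-))
  ultimately have aut: "mpM_automorphism ?F ?t"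
    by (simp add: mpM_automorphism_def)
  show ?thesis
    by unfold_locales
      (use aut cyc in \<open>((simp only: carrier_free_Ck, elim imageE)?, simp add: Ck_eq.intros(9-); fail)+\<close>)
qed

primrec eval :: "'a mpM_struct \<Rightarrow> ('a \<Rightarrow> 'a) \<Rightarrow> ('v \<Rightarrow> 'a) \<Rightarrow> 'v trm \<Rightarrow> 'a" where
  "eval B u f (Var i) = f i"
| "eval B u f (Meet x y) = meet B (eval B u f x) (eval B u f y)"
| "eval B u f (Join x y) = join B (eval B u f x) (eval B u f y)"
| "eval B u f (Neg x) = dneg B (eval B u f x)"
| "eval B u f (Star x) = star B (eval B u f x)"
| "eval B u f (Shift x) = u (eval B u f x)"
| "eval B u f Zero = lzero B"
| "eval B u f One = lone B"

context cyclic_mpM_algebra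
begin

lemma t_hom: "mpM_hom A A t"
  using automorphism by (simp add: mpM_automorphism_def)

lemma eval_closed: "(\<And>i. f i \<in> carrier A) \<Longrightarrow> eval A t f x \<in> carrier A"
  using t_hom
  by (induction x)
    (auto simp: mpM_hom_def meet_closed join_closed dneg_closed star_closed zero_closed one_closed)

lemma eval_funpow: "eval A t f ((Shift ^^ j) x) = (t ^^ j) (eval A t f x)"
  by (induction j) auto

lemma eval_sound:
  assumes "Ck_eq k x y" and f: "\<And>i. f i \<in> carrier A"
  shows "eval A t f x = eval A t f y"
proof -
  note axs = meet_commute join_commute meet_assoc join_assoc meet_absorb join_absorb distrib
    meet_zero join_one dneg_dneg dneg_meet meet_star_meet meet_star_zero star_star_zero
    join_dneg_le_join_star cyclic
  show ?thesis using assms(1)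
    by induction
      (use t_hom in \<open>simp_all add: eval_closed[OF f] eval_funpow mpM_hom_def axs\<close>)
qed

theorem free_Ck_universal:
  assumes f: "\<And>i. i < n \<Longrightarrow> f i \<in> carrier A"
  shows "\<exists>h. cyclic_mpM_hom (free_Ck k n) (free_shift k n) A t h \<and>
             (\<forall>i<n. h (free_gen k n i) = f i)"
proof -
  define f' where "f' i = (if i < n then f i else \<zero>)" for i
  have f': "\<And>i. f' i \<in> carrier A" using f zero_closed by (auto simp: f'_def)
  define h where "h X = eval A t f' (SOME x. x \<in> X)" for X
  have h: "h (cls k n x) = eval A t f' x" if "x \<in> trms n" for x
  proof -
    have "x \<in> cls k n x" using that by (auto simp: Ck_rel_def intro: Ck_eq.refl)
    then have "(SOME y. y \<in> cls k n x) \<in> cls k n x" by (rule someI)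
    then show ?thesis unfolding h_def
      using eval_sound[of x _ f', OF _ f', symmetric] by (auto simp: Ck_rel_def)
  qed
  have "cyclic_mpM_hom (free_Ck k n) (free_shift k n) A t h"
    by (auto simp: cyclic_mpM_hom_def mpM_hom_def carrier_free_Ck free_Ck_simps h eval_closed[OF f'])
  moreover have "\<forall>i<n. h (free_gen k n i) = f i"
    by (simp add: free_gen_def h f'_def)
  ultimately show ?thesis by blast
qed

theorem free_Ck_universal_unique:
  assumes g: "cyclic_mpM_hom (free_Ck k n) (free_shift k n) A t g"
    and h: "cyclic_mpM_hom (free_Ck k n) (free_shift k n) A t h"
    and eq: "\<And>i. i < n \<Longrightarrow> g (free_gen k n i) = h (free_gen k n i)"
    and X: "X \<in> carrier (free_Ck k n)"
  shows "g X = h X"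
proof -
  have "g (cls k n x) = h (cls k n x)" if "x \<in> trms n" for x
    using that
  proof (induction x)
    case (Var i) then show ?case using eq by (simp add: free_gen_def)
  qed (use g h in \<open>simp_all add: cyclic_mpM_hom_def mpM_hom_def carrier_free_Ck
         flip: free_Ck_simps\<close>)
  then show ?thesis using X by (auto simp: carrier_free_Ck)
qed

end


section \<open>The exponents\<close>

definition maximal_divisors :: "nat \<Rightarrow> nat set" where
  "maximal_divisors d =
     {x. x dvd d \<and> x \<noteq> d \<and> (\<forall>y. y dvd d \<and> y \<noteq> d \<and> x dvd y \<longrightarrow> y = x)}"

text \<open>The quotients are taken in the reals: \<open>\<alpha>\<^sub>4\<close> need not be an integer
  (for \<open>n = 1\<close> and \<open>d = 2\<close> it is \<open>5/2\<close>). The subsets \<open>Z\<close>, \<open>W\<close> and \<open>H\<close> are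
  nonempty, so the truncated subtraction in \<open>card Z - 1\<close> is harmless. \<open>Domain H\<close> and
  \<open>Range H\<close> are the projections \<open>H\<^sub>1\<close> and \<open>H\<^sub>2\<close>.\<close>

definition alpha2 :: "nat \<Rightarrow> nat \<Rightarrow> real" where
  "alpha2 n d =
     ((2 ^ d) ^ n
      - (\<Sum>Z | Z \<noteq> {} \<and> Z \<subseteq> maximal_divisors d. (- 1) ^ (card Z - 1) * (2 ^ Gcd Z) ^ n))
     / real d"

definition alpha3 :: "nat \<Rightarrow> nat \<Rightarrow> real" where
  "alpha3 n d =
     ((3 ^ d) ^ n - (2 ^ d) ^ n
      - (\<Sum>W | W \<noteq> {} \<and> W \<subseteq> maximal_divisors d. (- 1) ^ (card W - 1) * (3 ^ Gcd W) ^ n)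
      + (\<Sum>H | H \<noteq> {} \<and> H \<subseteq> maximal_divisors d \<times> maximal_divisors d.
           (- 1) ^ (card H - 1) * (2 ^ Gcd (Domain H \<union> Range H)) ^ n))
     / real d"

definition alpha4 :: "nat \<Rightarrow> nat \<Rightarrow> real" where
  "alpha4 n d =
     ((4 ^ d) ^ n
      - (\<Sum>W | W \<noteq> {} \<and> W \<subseteq> maximal_divisors d. (- 1) ^ (card W - 1) * (4 ^ Gcd W) ^ n)
      - (2 ^ d) ^ n
      + (\<Sum>H | H \<noteq> {} \<and> H \<subseteq> maximal_divisors d \<times> maximal_divisors d.
           (- 1) ^ (card H - 1) * (2 ^ Gcd (Domain H \<union> Range H)) ^ n))
     / (2 * real d)"

end

theory Submission
  imports Defs "HOL-Library.FuncSet"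
begin

text \<open>
  Three algebras, with two, three and four elements, suffice to describe all \<open>mpM\<close>-algebras:
  every algebra is a subdirect product of copies of \<open>T\<^sub>2\<close> (two elements), \<open>T\<^sub>3\<close> (a chain)
  and \<open>T\<^sub>4\<close> (the four-element De Morgan algebra with two fixed points of negation, with the
  Boolean complement as \<open>star\<close>). Indeed a prime filter \<open>P\<close> has a dual prime filter
  \<open>P' = {x. \<sim> x \<notin> P}\<close>, and \<open>x \<mapsto> (x \<in> P, x \<in> P')\<close> is always a De Morgan homomorphism into
  \<open>bool \<times> bool\<close>. The axioms on \<open>star\<close> force it to preserve \<open>star\<close> as well, where \<open>star\<close> on the
  image depends only on whether \<open>P\<close> and \<open>P'\<close> are comparable or not. In the first case the image lies
  in \<open>T\<^sub>3\<close>, possibly after \<open>P\<close> and \<open>P'\<close> are exchanged, in the second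
  case in \<open>T\<^sub>4\<close>. Prime filters separate points, hence so do these homomorphisms
  (\<open>dm_square_separates\<close>).

  A homomorphism \<open>h\<close> to \<open>T\<^sub>3\<close> or \<open>T\<^sub>4\<close> that ignores the automorphism \<open>t\<close> becomes one that respects
  it when \<open>x\<close> is sent to the \<open>k\<close>-periodic sequence \<open>j \<mapsto> h (t\<^sup>j x)\<close>. So for the free algebra such
  homomorphisms are given by arbitrary values for the \<open>N = n k\<close> elements \<open>t\<^sup>j g\<^sub>i\<close>, and the
  free algebra embeds into the product over all valuations (\<open>sem_complete\<close>). Some factors are
  redundant: a two-valued valuation needs only one factor \<open>T\<^sub>2\<close>, and two valuations in \<open>T\<^sub>4\<close>
  that differ by its nontrivial automorphism carry the same information. Once these
  redundancies are removed, distinct factors are told apart by which terms vanish there, and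
  this separation yields every function on the remaining factors, as in the Chinese remainder
  theorem (\<open>interpolating_term\<close>). There are \<open>2\<^sup>N\<close> factors \<open>T\<^sub>2\<close>, then \<open>3\<^sup>N - 2\<^sup>N\<close> factors \<open>T\<^sub>3\<close> and
  \<open>(4\<^sup>N - 2\<^sup>N) / 2\<close> factors \<open>T\<^sub>4\<close>, which gives the cardinality (\<open>card_free_Ck\<close>).

  It remains to see that the exponents \<open>d \<alpha>\<^sub>i\<^sub>,\<^sub>d\<close> of \<open>i\<close>, summed over \<open>d\<close> dividing \<open>k\<close>, are these
  three numbers (\<open>sum_alphas\<close>). Write \<open>q\<^sup>d\<^sup>n\<close> as a divisor sum \<open>\<Sum>e | e dvd d. g\<^sub>q e\<close>; then
  \<open>g\<^sub>q d\<close> counts the \<open>d\<close>-periodic sequences in a set with \<open>q\<^sup>n\<close> elements whose least period is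
  \<open>d\<close>. By inclusion-exclusion over the maximal divisors, each alternating sum in the definition
  of the \<open>\<alpha>\<close>s equals \<open>q\<^sup>d\<^sup>n - g\<^sub>q d\<close>, so the \<open>\<alpha>\<close>s are simple combinations of the \<open>g\<^sub>q d\<close>, whose sum
  over the divisors of \<open>k\<close> is \<open>q\<^sup>N\<close>. This is an identity of real numbers; no single \<open>\<alpha>\<close> has to
  be an integer.
\<close>

section \<open>Prime filters and homomorphisms to the simple algebras\<close>

context de_morgan_algebra
begin

lemma meet_idem: "x \<in> carrier A \<Longrightarrow> x \<sqinter> x = x"
  by (metis join_absorb join_closed meet_absorb)

lemma join_idem: "x \<in> carrier A \<Longrightarrow> x \<squnion> x = x"
  by (metis join_absorb meet_absorb join_closed)

lemma meet_one: "x \<in> carrier A \<Longrightarrow> x \<sqinter> \<one> = x"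
  by (metis join_one meet_absorb one_closed)

lemma join_meet_distrib:
  assumes "x \<in> carrier A" "y \<in> carrier A" "z \<in> carrier A"
  shows "(x \<sqinter> y) \<squnion> z = (x \<squnion> z) \<sqinter> (y \<squnion> z)"
proof -
  have "(x \<squnion> z) \<sqinter> (y \<squnion> z) = ((x \<squnion> z) \<sqinter> y) \<squnion> ((x \<squnion> z) \<sqinter> z)"
    using assms by (simp add: distrib join_closed)
  also have "(x \<squnion> z) \<sqinter> z = z"
    using assms by (metis join_closed join_commute meet_absorb meet_commute)
  also have "(x \<squnion> z) \<sqinter> y = (x \<sqinter> y) \<squnion> (z \<sqinter> y)"
    using assms by (metis distrib join_closed meet_commute)
  also have "\<dots> \<squnion> z = (x \<sqinter> y) \<squnion> z"
    using assms by (metis join_absorb join_assoc join_commute meet_closed)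
  finally show ?thesis ..
qed

lemma dneg_join:
  assumes "x \<in> carrier A" "y \<in> carrier A"
  shows "\<sim> (x \<squnion> y) = \<sim> x \<sqinter> \<sim> y"
  using dneg_meet[of "\<sim> x" "\<sim> y"] dneg_dneg[of "\<sim> x \<sqinter> \<sim> y"] assms
  by (simp add: dneg_closed dneg_dneg meet_closed)

lemma dneg_one: "\<sim> \<one> = \<zero>"
  using dneg_join[of "\<sim> \<zero>" \<one>] meet_zero[of "\<sim> \<one>"]
  by (simp add: join_one dneg_closed dneg_dneg one_closed zero_closed meet_commute)

lemma dneg_zero: "\<sim> \<zero> = \<one>"
  using dneg_dneg dneg_one one_closed by metis

text \<open>One equivalence expresses both that a filter is closed under meets and that it is
  upward closed, since \<open>x \<le> y\<close> means \<open>x \<sqinter> y = x\<close>. The empty set is admitted.\<close>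

definition lattice_filter :: "'a set \<Rightarrow> bool" where
  "lattice_filter P \<longleftrightarrow> P \<subseteq> carrier A \<and>
     (\<forall>x\<in>carrier A. \<forall>y\<in>carrier A. x \<sqinter> y \<in> P \<longleftrightarrow> x \<in> P \<and> y \<in> P)"

text \<open>These are the characteristic functions of the prime filters.\<close>

definition bool_hom :: "('a \<Rightarrow> bool) \<Rightarrow> bool" where
  "bool_hom \<phi> \<longleftrightarrow> \<phi> \<one> \<and> \<not> \<phi> \<zero> \<and>
     (\<forall>x\<in>carrier A. \<forall>y\<in>carrier A. \<phi> (x \<sqinter> y) \<longleftrightarrow> \<phi> x \<and> \<phi> y) \<and>
     (\<forall>x\<in>carrier A. \<forall>y\<in>carrier A. \<phi> (x \<squnion> y) \<longleftrightarrow> \<phi> x \<or> \<phi> y)"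

lemma bool_hom_meet:
  "bool_hom \<phi> \<Longrightarrow> x \<in> carrier A \<Longrightarrow> y \<in> carrier A \<Longrightarrow> \<phi> (x \<sqinter> y) \<longleftrightarrow> \<phi> x \<and> \<phi> y"
  by (simp add: bool_hom_def)

lemma bool_hom_join:
  "bool_hom \<phi> \<Longrightarrow> x \<in> carrier A \<Longrightarrow> y \<in> carrier A \<Longrightarrow> \<phi> (x \<squnion> y) \<longleftrightarrow> \<phi> x \<or> \<phi> y"
  by (simp add: bool_hom_def)

lemma filter_meet_iff:
  "lattice_filter P \<Longrightarrow> x \<in> carrier A \<Longrightarrow> y \<in> carrier A \<Longrightarrow> x \<sqinter> y \<in> P \<longleftrightarrow> x \<in> P \<and> y \<in> P"
  by (simp add: lattice_filter_def)

lemma filter_join: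
  assumes P: "lattice_filter P" and x: "x \<in> P" "y \<in> carrier A"
  shows "x \<squnion> y \<in> P"
proof -
  have "x \<in> carrier A" using P x by (auto simp: lattice_filter_def)
  then show ?thesis
    using filter_meet_iff[OF P, of x "x \<squnion> y"] x by (simp add: meet_absorb join_closed)
qed

lemma filter_principal:
  assumes "a \<in> carrier A"
  shows "lattice_filter {z \<in> carrier A. a \<sqinter> z = a}"
proof -
  have "a \<sqinter> (x \<sqinter> y) = a \<longleftrightarrow> a \<sqinter> x = a \<and> a \<sqinter> y = a"
    if "x \<in> carrier A" "y \<in> carrier A" for x y
    using assms that by (metis meet_assoc meet_closed meet_commute meet_idem)
  then show ?thesis by (auto simp: lattice_filter_def meet_closed)
qed

text \<open>By distributivity. Residuals let primeness of a maximal filter be shown without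
  describing the filter generated by a filter and one more element.\<close>

lemma filter_residual:
  assumes "lattice_filter P" "y \<in> carrier A"
  shows "lattice_filter {z \<in> carrier A. z \<squnion> y \<in> P}"
  using assms by (auto simp: lattice_filter_def join_meet_distrib meet_closed join_closed)

lemma filter_Union_chain:
  assumes "subset.chain {P. lattice_filter P} C"
  shows "lattice_filter (\<Union>C)"
  unfolding lattice_filter_def
proof (intro conjI ballI)
  show "\<Union>C \<subseteq> carrier A"
    using assms by (auto simp: subset.chain_def lattice_filter_def)
  fix x y assume xy: "x \<in> carrier A" "y \<in> carrier A"
  show "x \<sqinter> y \<in> \<Union>C \<longleftrightarrow> x \<in> \<Union>C \<and> y \<in> \<Union>C"
  proof
    assume "x \<sqinter> y \<in> \<Union>C"
    then obtain P where "P \<in> C" "x \<sqinter> y \<in> P" by blast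
    moreover from this have "lattice_filter P" using assms by (auto simp: subset.chain_def)
    ultimately show "x \<in> \<Union>C \<and> y \<in> \<Union>C" using xy filter_meet_iff by blast
  next
    assume "x \<in> \<Union>C \<and> y \<in> \<Union>C"
    then obtain P Q where PQ: "P \<in> C" "Q \<in> C" "x \<in> P" "y \<in> Q" by blast
    then have "P \<subseteq> Q \<or> Q \<subseteq> P" using assms by (auto simp: subset.chain_def)
    with PQ obtain R where "R \<in> C" "x \<in> R" "y \<in> R" by blast
    moreover from this have "lattice_filter R" using assms by (auto simp: subset.chain_def)
    ultimately show "x \<sqinter> y \<in> \<Union>C" using xy filter_meet_iff by blast
  qed
qed

text \<open>The prime filter theorem. Zorn's lemma gives a filter \<open>P\<close> that is maximal among those
  containing \<open>a\<close> but not \<open>b\<close>. If \<open>x \<squnion> y \<in> P\<close> and \<open>x \<notin> P\<close>, the residual \<open>{z. z \<squnion> y \<in> P}\<close>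
  properly extends \<open>P\<close>, so it contains \<open>b\<close>. Thus \<open>y\<close> is in the residual \<open>{z. z \<squnion> b \<in> P}\<close>,
  which does not contain \<open>b\<close> and hence equals \<open>P\<close> by maximality.\<close>

theorem bool_hom_separates:
  assumes a: "a \<in> carrier A" and b: "b \<in> carrier A" and ab: "a \<sqinter> b \<noteq> a"
  obtains \<phi> where "bool_hom \<phi>" "\<phi> a" "\<not> \<phi> b"
proof -
  let ?F = "{P. lattice_filter P \<and> a \<in> P \<and> b \<notin> P}"
  have "{z \<in> carrier A. a \<sqinter> z = a} \<in> ?F"
    using filter_principal a ab meet_idem by auto
  then have "?F \<noteq> {}" by blast
  moreover have "\<Union>C \<in> ?F" if "C \<noteq> {}" "subset.chain ?F C" for C
  proof -
    have "subset.chain {P. lattice_filter P} C"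
      using that by (auto simp: subset.chain_def)
    then have "lattice_filter (\<Union>C)" by (rule filter_Union_chain)
    moreover have "a \<in> \<Union>C" "b \<notin> \<Union>C"
      using that by (auto simp: subset.chain_def)
    ultimately show ?thesis by blast
  qed
  ultimately have "\<exists>P\<in>?F. \<forall>Q\<in>?F. P \<subseteq> Q \<longrightarrow> Q = P"
    by (rule subset_Zorn_nonempty)
  then obtain P where P: "lattice_filter P" "a \<in> P" "b \<notin> P"
    and max: "\<And>Q. lattice_filter Q \<Longrightarrow> b \<notin> Q \<Longrightarrow> P \<subseteq> Q \<Longrightarrow> Q = P"
    by blast
  have Pc: "P \<subseteq> carrier A" using P by (auto simp: lattice_filter_def)
  have prime: "x \<in> P \<or> y \<in> P"
    if x: "x \<in> carrier A" and y: "y \<in> carrier A" and xy: "x \<squnion> y \<in> P" for x y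
  proof (rule ccontr)
    assume non: "\<not> ?thesis"
    have sub: "P \<subseteq> {z \<in> carrier A. z \<squnion> w \<in> P}" if "w \<in> carrier A" for w
      using Pc filter_join[OF P(1)] that by blast
    have "b \<squnion> y \<in> P"
      using max[OF filter_residual[OF P(1) y]] sub[OF y] x xy non b by blast
    then have "y \<squnion> b \<in> P" using b y join_commute by simp
    then have "b \<squnion> b \<in> P"
      using max[OF filter_residual[OF P(1) b]] sub[OF b] y non b by blast
    then show False using P(3) b by (simp add: join_idem)
  qed
  have "bool_hom (\<lambda>x. x \<in> P)"
    unfolding bool_hom_def
  proof (intro conjI ballI)
    show "\<one> \<in> P"
      using filter_meet_iff[OF P(1) a one_closed] P(2) a by (simp add: meet_one)
    show "\<zero> \<notin> P"
      using filter_meet_iff[OF P(1) b zero_closed] P(3) b by (auto simp: meet_zero)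
    show "x \<sqinter> y \<in> P \<longleftrightarrow> x \<in> P \<and> y \<in> P" if "x \<in> carrier A" "y \<in> carrier A" for x y
      using that by (rule filter_meet_iff[OF P(1)])
    show "x \<squnion> y \<in> P \<longleftrightarrow> x \<in> P \<or> y \<in> P" if "x \<in> carrier A" "y \<in> carrier A" for x y
      using that prime filter_join[OF P(1)] join_commute by metis
  qed
  with P show thesis using that by blast
qed

text \<open>On prime filters this is the Bialynicki-Birula-Rasiowa involution of the dual space.\<close>

definition dual_hom :: "('a \<Rightarrow> bool) \<Rightarrow> 'a \<Rightarrow> bool" where
  "dual_hom \<phi> x \<longleftrightarrow> \<not> \<phi> (\<sim> x)"

lemma bool_hom_dual: "bool_hom \<phi> \<Longrightarrow> bool_hom (dual_hom \<phi>)"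
  by (auto simp: bool_hom_def dual_hom_def dneg_meet dneg_join dneg_one dneg_zero dneg_closed)

lemma dual_hom_dneg: "x \<in> carrier A \<Longrightarrow> dual_hom \<phi> (\<sim> x) \<longleftrightarrow> \<not> \<phi> x"
  by (simp add: dual_hom_def dneg_dneg)

end

text \<open>The two maximal simple algebras, both on pairs of truth values with negation
  \<open>(p, q) \<mapsto> (\<not> q, \<not> p)\<close>. For \<open>c = True\<close> it is \<open>T\<^sub>4\<close>, whose \<open>star\<close> is the Boolean complement.
  For \<open>c = False\<close> the carrier is the chain \<open>(False, False) < (False, True) < (True, True)\<close>,
  which is \<open>T\<^sub>3\<close>. The diagonal is a copy of \<open>T\<^sub>2\<close> inside both.\<close>

definition dm_square :: "bool \<Rightarrow> (bool \<times> bool) mpM_struct" where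
  "dm_square c =
    \<lparr> carrier = {x. c \<or> (fst x \<longrightarrow> snd x)},
      meet = (\<lambda>x y. (fst x \<and> fst y, snd x \<and> snd y)),
      join = (\<lambda>x y. (fst x \<or> fst y, snd x \<or> snd y)),
      dneg = (\<lambda>x. (\<not> snd x, \<not> fst x)),
      star = (\<lambda>x. (if c then \<not> fst x else \<not> snd x, \<not> snd x)),
      lzero = (False, False),
      lone = (True, True) \<rparr>"

lemma dm_square_mpM_algebra: "mpM_algebra (dm_square c)"
  by unfold_locales (simp_all add: dm_square_def, (blast | fastforce)+)

context mpM_algebra
begin

lemma star_zero: "\<zero>\<star> = \<one>"
  using meet_star_zero[of \<one>] meet_one[of "\<zero>\<star>"] meet_commute[of \<one> "\<zero>\<star>"]
  by (simp add: star_closed one_closed zero_closed)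

lemma star_one: "\<one>\<star> = \<zero>"
  using star_star_zero star_zero by simp

lemma meet_star_self: "x \<in> carrier A \<Longrightarrow> x \<sqinter> x\<star> = \<zero>"
  using meet_star_meet[of x \<one>] by (simp add: meet_one one_closed star_one meet_zero)

lemma bool_hom_star_disjoint:
  assumes "bool_hom \<phi>" "x \<in> carrier A" "\<phi> x"
  shows "\<not> \<phi> (x\<star>)"
  using bool_hom_meet[OF assms(1,2) star_closed[OF assms(2)]] assms
  by (simp add: meet_star_self bool_hom_def)

text \<open>Here \<open>\<phi>\<close> holds of \<open>\<sim> x\<close>, so the axiom \<open>x \<squnion> \<sim> x \<le> x \<squnion> x\<star>\<close> puts \<open>x \<squnion> x\<star>\<close> in
  the prime filter.\<close>

lemma bool_hom_star_outside:
  assumes \<phi>: "bool_hom \<phi>" and x: "x \<in> carrier A" and "\<not> \<phi> x" "\<not> dual_hom \<phi> x"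
  shows "\<phi> (x\<star>)"
proof -
  have "\<phi> (x \<squnion> \<sim> x)"
    using assms by (simp add: bool_hom_join dual_hom_def dneg_closed)
  then have "\<phi> ((x \<squnion> \<sim> x) \<sqinter> (x \<squnion> x\<star>))"
    using x by (simp add: join_dneg_le_join_star)
  then have "\<phi> (x \<squnion> x\<star>)"
    using x by (simp add: bool_hom_meet[OF \<phi>] join_closed dneg_closed star_closed)
  then show ?thesis
    using assms by (simp add: bool_hom_join star_closed)
qed

text \<open>A witness \<open>w\<close> that the prime filter is not contained in its dual reduces the claim to
  \<open>bool_hom_star_outside\<close>: the element \<open>w \<sqinter> x\<close> lies in neither of the two, and
  \<open>w \<sqinter> (w \<sqinter> x)\<star> = w \<sqinter> x\<star>\<close>.\<close>

lemma bool_hom_star_incomparable: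
  assumes \<phi>: "bool_hom \<phi>" and x: "x \<in> carrier A" and "\<not> \<phi> x"
    and w: "w \<in> carrier A" "\<phi> w" "\<not> dual_hom \<phi> w"
  shows "\<phi> (x\<star>)"
proof -
  have \<psi>: "bool_hom (dual_hom \<phi>)" using \<phi> by (rule bool_hom_dual)
  have c: "w \<sqinter> x \<in> carrier A" using w x by (simp add: meet_closed)
  have "\<not> \<phi> (w \<sqinter> x)" "\<not> dual_hom \<phi> (w \<sqinter> x)"
    using x w assms(3) bool_hom_meet[OF \<phi>, of w x] bool_hom_meet[OF \<psi>, of w x] by blast+
  then have "\<phi> ((w \<sqinter> x)\<star>)" by (rule bool_hom_star_outside[OF \<phi> c])
  then have "\<phi> (w \<sqinter> (w \<sqinter> x)\<star>)"
    using w c bool_hom_meet[OF \<phi>, of w "(w \<sqinter> x)\<star>"] star_closed[OF c] by blast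
  then show ?thesis
    using w x bool_hom_meet[OF \<phi>, of w "x\<star>"] star_closed[OF x] by (simp add: meet_star_meet)
qed

lemma dual_hom_dual: "x \<in> carrier A \<Longrightarrow> dual_hom (dual_hom \<phi>) x = \<phi> x"
  by (simp add: dual_hom_def dneg_dneg)

text \<open>If \<open>\<phi>\<close> and its dual \<open>\<psi>\<close> are incomparable, both treat \<open>star\<close> as complementation. If \<open>\<phi>\<close>
  implies \<open>\<psi>\<close>, then \<open>star x\<close> is outside \<open>\<phi>\<close> as soon as \<open>\<psi> x\<close>, because it is outside \<open>\<psi>\<close>.\<close>

lemma mpM_hom_dm_square:
  assumes \<phi>: "bool_hom \<phi>"
    and c: "if c then (\<exists>w\<in>carrier A. \<phi> w \<and> \<not> dual_hom \<phi> w) \<and> (\<exists>w\<in>carrier A. dual_hom \<phi> w \<and> \<not> \<phi> w)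
            else (\<forall>w\<in>carrier A. \<phi> w \<longrightarrow> dual_hom \<phi> w)"
  shows "mpM_hom A (dm_square c) (\<lambda>x. (\<phi> x, dual_hom \<phi> x))"
proof -
  let ?\<psi> = "dual_hom \<phi>"
  have \<psi>: "bool_hom ?\<psi>" using \<phi> by (rule bool_hom_dual)
  have star: "\<phi> (x\<star>) = (if c then \<not> \<phi> x else \<not> ?\<psi> x) \<and> ?\<psi> (x\<star>) = (\<not> ?\<psi> x)"
    if x: "x \<in> carrier A" for x
  proof (cases c)
    case True
    then obtain w w' where w: "w \<in> carrier A" "\<phi> w" "\<not> ?\<psi> w"
      and w': "w' \<in> carrier A" "?\<psi> w'" "\<not> \<phi> w'"
      using c by auto
    show ?thesis
      using True x bool_hom_star_disjoint[OF \<phi> x] bool_hom_star_disjoint[OF \<psi> x]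
        bool_hom_star_incomparable[OF \<phi> x _ w] bool_hom_star_incomparable[OF \<psi> x _ w'(1,2)] w'
      by (auto simp: dual_hom_dual)
  next
    case False
    then have le: "\<And>w. w \<in> carrier A \<Longrightarrow> \<phi> w \<Longrightarrow> ?\<psi> w" using c by auto
    show ?thesis
      using False x le[OF x] le[OF star_closed[OF x]] bool_hom_star_disjoint[OF \<psi> x]
        bool_hom_star_outside[OF \<phi> x] bool_hom_star_outside[OF \<psi> x]
      by (auto simp: dual_hom_dual)
  qed
  have le: "c \<or> (\<phi> x \<longrightarrow> ?\<psi> x)" if "x \<in> carrier A" for x
    using c that by (auto split: if_splits)
  show ?thesis
    unfolding mpM_hom_def
  proof (intro conjI ballI)
    fix x assume x: "x \<in> carrier A"
    show "(\<phi> x, ?\<psi> x) \<in> carrier (dm_square c)"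
      using le[OF x] by (simp add: dm_square_def)
    show "(\<phi> (\<sim> x), ?\<psi> (\<sim> x)) = \<sim>\<^bsub>dm_square c\<^esub> (\<phi> x, ?\<psi> x)"
      using dual_hom_dneg[OF x] by (simp add: dm_square_def) (simp add: dual_hom_def)
    show "(\<phi> (x\<star>), ?\<psi> (x\<star>)) = (\<phi> x, ?\<psi> x)\<star>\<^bsub>dm_square c\<^esub>"
      using star[OF x] by (simp add: dm_square_def)
    fix y assume y: "y \<in> carrier A"
    show "(\<phi> (x \<sqinter> y), ?\<psi> (x \<sqinter> y)) = (\<phi> x, ?\<psi> x) \<sqinter>\<^bsub>dm_square c\<^esub> (\<phi> y, ?\<psi> y)"
      using \<phi> \<psi> x y by (simp add: dm_square_def bool_hom_def)
    show "(\<phi> (x \<squnion> y), ?\<psi> (x \<squnion> y)) = (\<phi> x, ?\<psi> x) \<squnion>\<^bsub>dm_square c\<^esub> (\<phi> y, ?\<psi> y)"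
      using \<phi> \<psi> x y by (simp add: dm_square_def bool_hom_def)
  qed (use \<phi> \<psi> in \<open>simp_all add: dm_square_def bool_hom_def\<close>)
qed

text \<open>If the dual of \<open>\<phi>\<close> implies \<open>\<phi>\<close>, exchanging the two gives a map into the chain, because
  dualising is an involution.\<close>

theorem dm_square_separates:
  assumes x: "x \<in> carrier A" and y: "y \<in> carrier A" and "x \<noteq> y"
  obtains c h where "mpM_hom A (dm_square c) h" "h x \<noteq> h y"
proof -
  have "x \<sqinter> y \<noteq> x \<or> y \<sqinter> x \<noteq> y"
    using assms by (metis meet_commute)
  then obtain \<phi> where \<phi>: "bool_hom \<phi>" and xy: "\<phi> x \<noteq> \<phi> y"
    using bool_hom_separates[OF x y] bool_hom_separates[OF y x] by metis
  have \<psi>: "bool_hom (dual_hom \<phi>)" using \<phi> by (rule bool_hom_dual)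
  consider "\<forall>w\<in>carrier A. \<phi> w \<longrightarrow> dual_hom \<phi> w" | "\<forall>w\<in>carrier A. dual_hom \<phi> w \<longrightarrow> \<phi> w"
    | "(\<exists>w\<in>carrier A. \<phi> w \<and> \<not> dual_hom \<phi> w) \<and> (\<exists>w\<in>carrier A. dual_hom \<phi> w \<and> \<not> \<phi> w)"
    by blast
  then show thesis
  proof cases
    case 1
    then show thesis
      using xy by (intro that[OF mpM_hom_dm_square[OF \<phi>, of False]]) auto
  next
    case 2
    then show thesis
      using xy x y
      by (intro that[OF mpM_hom_dm_square[OF \<psi>, of False]]) (auto simp: dual_hom_dual)
  next
    case 3
    then show thesis
      using xy by (intro that[OF mpM_hom_dm_square[OF \<phi>, of True]]) auto
  qed
qed

end

section \<open>Cyclic powers and the evaluation of terms\<close>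

text \<open>The \<open>k\<close>-periodic sequences in \<open>B\<close>, indexed by all natural numbers so that no arithmetic
  modulo \<open>k\<close> is needed to shift them. With the shift this is the cofree \<open>k\<close>-cyclic algebra over \<open>B\<close>.\<close>

definition cyclic_power :: "nat \<Rightarrow> 'a mpM_struct \<Rightarrow> (nat \<Rightarrow> 'a) mpM_struct" where
  "cyclic_power k B =
    \<lparr> carrier = {f. \<forall>j. f j \<in> carrier B \<and> f (j + k) = f j},
      meet = (\<lambda>f g j. meet B (f j) (g j)),
      join = (\<lambda>f g j. join B (f j) (g j)),
      dneg = (\<lambda>f j. dneg B (f j)),
      star = (\<lambda>f j. star B (f j)),
      lzero = (\<lambda>j. lzero B),
      lone = (\<lambda>j. lone B) \<rparr>"

definition shift :: "(nat \<Rightarrow> 'a) \<Rightarrow> nat \<Rightarrow> 'a" where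
  "shift f j = f (Suc j)"

lemma shift_funpow: "(shift ^^ i) f j = f (i + j)"
  by (induction i arbitrary: j) (simp_all add: shift_def)

lemma cyclic_power_cyclic_mpM_algebra:
  assumes "mpM_algebra B" and k: "k \<ge> 1"
  shows "cyclic_mpM_algebra (cyclic_power k B) k shift"
proof -
  interpret mpM_algebra B by fact
  let ?P = "cyclic_power k B"
  have pow: "(shift ^^ k) f = f" if "f \<in> carrier ?P" for f
    using that by (auto simp: fun_eq_iff shift_funpow cyclic_power_def add.commute)
  have closed: "(shift ^^ i) f \<in> carrier ?P" if "f \<in> carrier ?P" for f i
    using that by (auto simp: cyclic_power_def shift_funpow add.assoc simp flip: add.assoc)
  have closed1: "shift f \<in> carrier ?P" if "f \<in> carrier ?P" for f
    using closed[OF that, of 1] by simp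
  have "bij_betw shift (carrier ?P) (carrier ?P)"
  proof (rule bij_betw_byWitness[where f' = "shift ^^ (k - 1)"])
    have k': "k = Suc (k - 1)" using k by simp
    show "\<forall>f\<in>carrier ?P. (shift ^^ (k - 1)) (shift f) = f"
      using pow k' by (metis comp_apply funpow_Suc_right)
    show "\<forall>f\<in>carrier ?P. shift ((shift ^^ (k - 1)) f) = f"
      using pow k' by (metis comp_apply funpow.simps(2))
  qed (use closed closed1 in blast)+
  moreover have "mpM_hom ?P ?P shift"
    unfolding mpM_hom_def by (simp add: closed1, simp add: cyclic_power_def shift_def[abs_def])
  ultimately have "mpM_automorphism ?P shift"
    by (simp add: mpM_automorphism_def)
  moreover note ax = meet_closed join_closed dneg_closed star_closed zero_closed one_closed
    meet_assoc join_assoc meet_absorb join_absorb distrib meet_zero join_one dneg_dneg dneg_meet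
    meet_star_meet meet_star_zero star_star_zero join_dneg_le_join_star
  ultimately show ?thesis
    using pow
    by unfold_locales
      (simp_all add: cyclic_power_def ax, auto simp: fun_eq_iff intro: meet_commute join_commute)
qed

text \<open>The value of a valuation at \<open>(i, j)\<close> is meant for the \<open>j\<close>-th shift of the \<open>i\<close>-th generator.\<close>

type_synonym valuation = "nat \<times> nat \<Rightarrow> bool \<times> bool"

text \<open>The sequence of values along the orbit of the \<open>i\<close>-th generator. Variables that do not
  occur get the constant zero sequence, so that all values lie in the cyclic power.\<close>

definition gens :: "nat \<Rightarrow> nat \<Rightarrow> valuation \<Rightarrow> nat \<Rightarrow> nat \<Rightarrow> bool \<times> bool" where
  "gens n k v i j = (if i < n then v (i, j mod k) else (False, False))"

text \<open>A pair \<open>\<iota>\<close> of a simple algebra and a valuation is treated as a point at which terms are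
  evaluated. The last argument is the index in the resulting periodic sequence; the value proper
  of a term at \<open>\<iota>\<close> is the one at index \<open>0\<close>, and the others are the values of its shifts.\<close>

definition sem :: "nat \<Rightarrow> nat \<Rightarrow> bool \<times> valuation \<Rightarrow> nat trm \<Rightarrow> nat \<Rightarrow> bool \<times> bool" where
  "sem n k \<iota> = eval (cyclic_power k (dm_square (fst \<iota>))) shift (gens n k (snd \<iota>))"

lemma sem_simps [simp]:
  "sem n k \<iota> (Var i) j = gens n k (snd \<iota>) i j"
  "sem n k \<iota> (Meet x y) j = 
     (fst (sem n k \<iota> x j) \<and> fst (sem n k \<iota> y j), snd (sem n k \<iota> x j) \<and> snd (sem n k \<iota> y j))"
  "sem n k \<iota> (Join x y) j = 
     (fst (sem n k \<iota> x j) \<or> fst (sem n k \<iota> y j), snd (sem n k \<iota> x j) \<or> snd (sem n k \<iota> y j))"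
  "sem n k \<iota> (Neg x) j = (\<not> snd (sem n k \<iota> x j), \<not> fst (sem n k \<iota> x j))"
  "sem n k \<iota> (Star x) j =
     (if fst \<iota> then \<not> fst (sem n k \<iota> x j) else \<not> snd (sem n k \<iota> x j), \<not> snd (sem n k \<iota> x j))"
  "sem n k \<iota> (Shift x) j = sem n k \<iota> x (Suc j)"
  "sem n k \<iota> Zero j = (False, False)"
  "sem n k \<iota> One j = (True, True)"
  by (simp_all add: sem_def cyclic_power_def dm_square_def shift_def)

lemma sem_funpow_Shift: "sem n k \<iota> ((Shift ^^ i) x) j = sem n k \<iota> x (i + j)"
  by (induction i arbitrary: j) auto

abbreviation vals :: "nat \<Rightarrow> nat \<Rightarrow> (bool \<times> bool) set \<Rightarrow> valuation set" where
  "vals n k S \<equiv> ({..<n} \<times> {..<k}) \<rightarrow>\<^sub>E S"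

abbreviation diag :: "(bool \<times> bool) set" where
  "diag \<equiv> {(False, False), (True, True)}"

lemma finite_vals: "finite (vals n k S)"
  by (rule finite_PiE) (auto intro: finite_subset[OF subset_UNIV])

lemma gens_carrier:
  assumes k: "k \<ge> 1" and v: "v \<in> vals n k (carrier (dm_square c))"
  shows "gens n k v i \<in> carrier (cyclic_power k (dm_square c))"
proof -
  have "(False, False) \<in> carrier (dm_square c)"
    by (simp add: dm_square_def)
  then have "gens n k v i j \<in> carrier (dm_square c)" for j
    using k PiE_mem[OF v, of "(i, j mod k)"] by (simp add: gens_def)
  then show ?thesis
    by (simp add: cyclic_power_def gens_def)
qed

lemma sem_sound:
  assumes k: "k \<ge> 1" and v: "v \<in> vals n k (carrier (dm_square c))" and xy: "Ck_eq k x y"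
  shows "sem n k (c, v) x = sem n k (c, v) y"
proof -
  interpret cyclic_mpM_algebra "cyclic_power k (dm_square c)" k shift
    by (intro cyclic_power_cyclic_mpM_algebra dm_square_mpM_algebra k)
  show ?thesis
    using eval_sound[OF xy gens_carrier[OF k v]] by (simp add: sem_def)
qed

lemma sem_carrier:
  assumes k: "k \<ge> 1" and v: "v \<in> vals n k (carrier (dm_square c))"
  shows "sem n k (c, v) x j \<in> carrier (dm_square c)"
proof -
  interpret cyclic_mpM_algebra "cyclic_power k (dm_square c)" k shift
    by (intro cyclic_power_cyclic_mpM_algebra dm_square_mpM_algebra k)
  show ?thesis
    using eval_closed[of "gens n k v", OF gens_carrier[OF k v], of x]
    by (simp add: sem_def cyclic_power_def)
qed

text \<open>In the free algebra, separate the classes of \<open>x\<close> and \<open>y\<close> by an \<open>mpM\<close>-homomorphism \<open>h\<close>. Composed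
  with the powers of the shift, \<open>h\<close> gives the valuation, and induction on terms shows that \<open>sem\<close>
  computes these compositions.\<close>

theorem sem_complete:
  assumes k: "k \<ge> 1" and x: "x \<in> trms n" and y: "y \<in> trms n" and xy: "\<not> Ck_eq k x y"
  obtains c v where "v \<in> vals n k (carrier (dm_square c))" "sem n k (c, v) x 0 \<noteq> sem n k (c, v) y 0"
proof -
  interpret F: cyclic_mpM_algebra "free_Ck k n" k "free_shift k n"
    by (rule free_Ck_cyclic_mpM_algebra[OF k])
  have "cls k n x \<in> carrier (free_Ck k n)" "cls k n y \<in> carrier (free_Ck k n)" "cls k n x \<noteq> cls k n y"
    using x y xy by (auto simp: carrier_free_Ck cls_eq_iff)
  then obtain c h where h: "mpM_hom (free_Ck k n) (dm_square c) h" and hxy: "h (cls k n x) \<noteq> h (cls k n y)"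
    by (rule F.dm_square_separates)
  define H where "H j X = h ((free_shift k n ^^ j) X)" for j X
  have H: "mpM_hom (free_Ck k n) (dm_square c) (H j)" for j
  proof (induction j)
    case 0
    then show ?case using h by (simp add: H_def[abs_def])
  next
    case (Suc j)
    then show ?case
      using F.t_hom by (simp add: mpM_hom_def H_def funpow_swap1)
  qed
  define v :: valuation
    where "v = (\<lambda>(i, j)\<in>{..<n} \<times> {..<k}. H j (cls k n (Var i)))"
  have v: "v \<in> vals n k (carrier (dm_square c))"
    using H by (auto simp: v_def mpM_hom_def carrier_free_Ck)
  have hs: "H j (cls k n z) = sem n k (c, v) z j" if "z \<in> trms n" for z j
    using that
  proof (induction z arbitrary: j)
    case (Var i)
    then have "H j (cls k n (Var i)) = H (j mod k) (cls k n (Var i))"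
      using F.cyclic[of "cls k n (Var i)"] by (simp add: H_def funpow_mod_eq carrier_free_Ck)
    then show ?case using Var k by (simp add: gens_def v_def)
  next
    case (Shift z)
    then have "H j (cls k n (Shift z)) = H (Suc j) (cls k n z)"
      by (simp add: H_def funpow_swap1 free_Ck_simps)
    then show ?case using Shift by simp
  qed (use H in \<open>simp_all add: mpM_hom_def carrier_free_Ck dm_square_def flip: free_Ck_simps\<close>)
  show thesis
    using that[OF v] hs[OF x, of 0] hs[OF y, of 0] hxy by (simp add: H_def)
qed

lemma sem_crisp:
  assumes k: "k \<ge> 1" and v: "v \<in> vals n k diag"
  shows "fst (sem n k (c, v) x j) = snd (sem n k (c, v) x j)"
proof (induction x arbitrary: j)
  case (Var i)
  then show ?case using k PiE_mem[OF v, of "(i, j mod k)"] by (auto simp: gens_def)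
qed auto

text \<open>On the diagonal the operation \<open>star\<close> of \<open>T\<^sub>3\<close> agrees with that of \<open>T\<^sub>4\<close>.\<close>

lemma sem_kind_irrelevant:
  assumes k: "k \<ge> 1" and v: "v \<in> vals n k diag"
  shows "sem n k (c, v) x j = sem n k (c', v) x j"
proof (induction x arbitrary: j)
  case (Star x)
  have "snd (sem n k (c, v) x j) = snd (sem n k (c', v) x j)"
    by (simp only: Star[of j])
  then show ?case by (cases c; cases c'; simp add: sem_crisp[OF k v])
qed auto

definition swap_val :: "nat \<Rightarrow> nat \<Rightarrow> valuation \<Rightarrow> valuation" where
  "swap_val n k v = (\<lambda>g\<in>{..<n} \<times> {..<k}. prod.swap (v g))"

text \<open>Exchanging the two coordinates is an automorphism of \<open>T\<^sub>4\<close>.\<close>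

lemma sem_swap_val:
  assumes k: "k \<ge> 1"
  shows "sem n k (True, swap_val n k v) x j = prod.swap (sem n k (True, v) x j)"
proof (induction x arbitrary: j)
  case (Var i)
  then show ?case using k by (auto simp: gens_def swap_val_def)
qed (auto simp: prod_eq_iff)

section \<open>The free algebra as a product of simple algebras\<close>

text \<open>The transversal consists of an arbitrarily chosen element of each orbit \<open>{x, s x}\<close>.\<close>

lemma involution_transversal:
  assumes inv: "\<And>x. x \<in> X \<Longrightarrow> s x \<in> X \<and> s (s x) = x \<and> s x \<noteq> x"
  obtains R where "R \<subseteq> X" "R \<inter> s ` R = {}" "R \<union> s ` R = X"
proof -
  define r where "r x = (SOME y. y \<in> {x, s x})" for x
  have rs: "r (s x) = r x" if "x \<in> X" for x
    using inv[OF that] by (simp add: r_def insert_commute)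
  have r: "r x \<in> {x, s x}" for x
    unfolding r_def by (rule someI[of _ x]) simp
  define R where "R = {x \<in> X. r x = x}"
  have "R \<inter> s ` R = {}"
  proof -
    have False if "x \<in> X" "r x = x" "r (s x) = s x" for x
      using that inv[of x] rs[of x] by simp
    then show ?thesis by (auto simp: R_def)
  qed
  moreover have "X \<subseteq> R \<union> s ` R"
  proof
    fix x assume x: "x \<in> X"
    consider "r x = x" | "r x = s x" using r[of x] by blast
    then show "x \<in> R \<union> s ` R"
    proof cases
      case 1
      with x show ?thesis by (simp add: R_def)
    next
      case 2
      then have "s x \<in> R" using inv[OF x] rs[OF x] by (simp add: R_def)
      then have "s (s x) \<in> s ` R" by (rule imageI)
      with inv[OF x] show ?thesis by simp
    qed
  qed
  moreover have "R \<union> s ` R \<subseteq> X"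
    using inv by (auto simp: R_def)
  ultimately show thesis
    using that[of R] by (auto simp: R_def)
qed

lemma bij_betw_image_same_kernel:
  assumes "\<And>x y. x \<in> A \<Longrightarrow> y \<in> A \<Longrightarrow> f x = f y \<longleftrightarrow> g x = g y"
  shows "\<exists>h. bij_betw h (f ` A) (g ` A)"
proof
  have "g (inv_into A f (f x)) = g x" if "x \<in> A" for x
    using assms[of "inv_into A f (f x)" x] that by (simp add: f_inv_into_f inv_into_into)
  then show "bij_betw (\<lambda>z. g (inv_into A f z)) (f ` A) (g ` A)"
    using assms by (auto simp: bij_betw_def inj_on_def image_image)
qed

text \<open>\<open>R\<close> contains one of each two valuations in \<open>T\<^sub>4\<close> that are exchanged by its automorphism.
  Valuations in the diagonal are left out of \<open>R\<close>, since the chain already provides the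
  points that belong to them.\<close>

locale point_system =
  fixes n k :: nat and R :: "valuation set"
  assumes k: "k \<ge> 1"
    and R_sub: "R \<subseteq> vals n k UNIV - vals n k diag"
    and R_disj: "R \<inter> swap_val n k ` R = {}"
    and R_cover: "R \<union> swap_val n k ` R = vals n k UNIV - vals n k diag"
begin

definition points :: "(bool \<times> valuation) set" where
  "points = Pair False ` vals n k (carrier (dm_square False)) \<union> Pair True ` R"

text \<open>The subalgebra of values that terms can take at a point.\<close>

definition factor :: "bool \<times> valuation \<Rightarrow> (bool \<times> bool) set" where
  "factor \<iota> = (if snd \<iota> \<in> vals n k diag then diag else carrier (dm_square (fst \<iota>)))"

lemma dm_square_carrier:
  "carrier (dm_square True) = UNIV"
  "carrier (dm_square False) = {(False, False), (False, True), (True, True)}"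
  by (auto simp: dm_square_def)

lemma point_valuation: "(c, v) \<in> points \<Longrightarrow> v \<in> vals n k (carrier (dm_square c))"
  using R_sub by (auto simp: points_def dm_square_carrier(1))

lemma point_True_nondiag: "(True, v) \<in> points \<Longrightarrow> v \<notin> vals n k diag"
  using R_sub by (auto simp: points_def)

lemma finite_points: "finite points"
proof -
  have "finite R" using R_sub by (rule finite_subset) (simp add: finite_vals)
  then show ?thesis by (simp add: points_def finite_vals)
qed

lemma sem_in_factor:
  assumes "\<iota> \<in> points"
  shows "sem n k \<iota> x 0 \<in> factor \<iota>"
proof (cases "snd \<iota> \<in> vals n k diag")
  case True
  then have "fst (sem n k \<iota> x 0) = snd (sem n k \<iota> x 0)"
    using sem_crisp[OF k, of "snd \<iota>" n "fst \<iota>" x 0] by simp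
  with True show ?thesis
    by (cases "sem n k \<iota> x 0") (auto simp: factor_def)
next
  case False
  then show ?thesis
    using sem_carrier[OF k point_valuation, of "fst \<iota>" "snd \<iota>" x 0] assms by (simp add: factor_def)
qed

text \<open>Completeness survives the removal of redundant points: a valuation in \<open>T\<^sub>4\<close> that is not
  in \<open>R\<close> is diagonal, where the chain gives the same values, or the swap of one in \<open>R\<close>.\<close>

lemma Ck_eq_iff_points:
  assumes x: "x \<in> trms n" and y: "y \<in> trms n"
  shows "Ck_eq k x y \<longleftrightarrow> (\<forall>\<iota>\<in>points. sem n k \<iota> x 0 = sem n k \<iota> y 0)"
proof
  assume "Ck_eq k x y"
  then show "\<forall>\<iota>\<in>points. sem n k \<iota> x 0 = sem n k \<iota> y 0"
    using sem_sound[OF k point_valuation] by (metis prod.collapse)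
next
  assume eq: "\<forall>\<iota>\<in>points. sem n k \<iota> x 0 = sem n k \<iota> y 0"
  show "Ck_eq k x y"
  proof (rule ccontr)
    assume "\<not> Ck_eq k x y"
    then obtain c v where v: "v \<in> vals n k (carrier (dm_square c))"
      and ne: "sem n k (c, v) x 0 \<noteq> sem n k (c, v) y 0"
      by (rule sem_complete[OF k x y])
    have False_case: "sem n k (False, w) x 0 = sem n k (False, w) y 0"
      if "w \<in> vals n k (carrier (dm_square False))" for w
      using eq that by (auto simp: points_def)
    have c: "c"
      using False_case ne v by (cases c) auto
    show False
    proof (cases "v \<in> vals n k diag")
      case True
      then have "v \<in> vals n k (carrier (dm_square False))"
        using PiE_mono[of "{..<n} \<times> {..<k}" "\<lambda>_. diag" "\<lambda>_. carrier (dm_square False)"]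
        by (auto simp: dm_square_carrier)
      with False_case ne sem_kind_irrelevant[OF k True] show False by metis
    next
      case False
      then have "v \<in> R \<union> swap_val n k ` R"
        using v c R_cover by (simp add: dm_square_carrier)
      then obtain r where r: "r \<in> R" "v = r \<or> v = swap_val n k r" by blast
      have "sem n k (True, r) x 0 = sem n k (True, r) y 0"
        using eq r by (auto simp: points_def)
      with r ne c show False by (auto simp: sem_swap_val[OF k])
    qed
  qed
qed

definition gen :: "nat \<times> nat \<Rightarrow> nat trm" where
  "gen g = (Shift ^^ snd g) (Var (fst g))"

lemma gen_trms: "g \<in> {..<n} \<times> {..<k} \<Longrightarrow> gen g \<in> trms n"
  by (auto simp: gen_def)

lemma sem_gen: "g \<in> {..<n} \<times> {..<k} \<Longrightarrow> sem n k \<iota> (gen g) 0 = snd \<iota> g"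
  by (auto simp: gen_def sem_funpow_Shift gens_def)

lemma nondiag_generator:
  assumes "v \<in> vals n k S" "v \<notin> vals n k diag"
  obtains g where "g \<in> {..<n} \<times> {..<k}" "v g \<notin> diag"
  using assms unfolding PiE_iff by blast

text \<open>A homomorphism to a simple algebra is determined by its zero set up to an isomorphism
  of its image. Concretely, the vanishing of a generator and of its negation tells whether it is
  mapped to \<open>0\<close>, to \<open>1\<close> or in between. On an element in between, \<open>star\<close> vanishes in \<open>T\<^sub>3\<close>
  but not in \<open>T\<^sub>4\<close>. In \<open>T\<^sub>4\<close>, two generators in between are mapped to different elements iff their
  meet vanishes; thus the valuations agree up to the swap, and \<open>R\<close> excludes the swap.\<close>

lemma points_eqI:
  assumes p: "\<iota> \<in> points" "\<iota>' \<in> points"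
    and eq: "\<And>x. x \<in> trms n \<Longrightarrow> sem n k \<iota> x 0 = (False, False) \<longleftrightarrow> sem n k \<iota>' x 0 = (False, False)"
  shows "\<iota> = \<iota>'"
proof -
  obtain c v c' v' where \<iota>: "\<iota> = (c, v)" "\<iota>' = (c', v')" by (metis prod.collapse)
  let ?V = "{..<n} \<times> {..<k}"
  note v = point_valuation[OF p(1)[unfolded \<iota>]] and v' = point_valuation[OF p(2)[unfolded \<iota>]]
  have crisp: "v g = v' g \<or> v g \<notin> diag \<and> v' g \<notin> diag" if g: "g \<in> ?V" for g
    using eq[of "gen g"] eq[of "Neg (gen g)"] gen_trms[OF g] sem_gen[OF g]
    by (cases "v g"; cases "v' g") (auto simp: \<iota>)
  have kind: "\<not> (d \<noteq> d' \<and> d)" if dw: "(d, w) \<in> points" "(d', w') \<in> points"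
    and eq: "\<And>x. x \<in> trms n \<Longrightarrow> sem n k (d, w) x 0 = (False, False) \<longleftrightarrow> sem n k (d', w') x 0 = (False, False)"
    and crisp: "\<And>g. g \<in> ?V \<Longrightarrow> w g = w' g \<or> w g \<notin> diag \<and> w' g \<notin> diag" for d d' w w'
  proof
    assume d: "d \<noteq> d' \<and> d"
    then have "w \<notin> vals n k diag"
      using dw(1) by (auto dest: point_True_nondiag)
    then obtain g where g: "g \<in> ?V" "w g \<notin> diag"
      by (rule nondiag_generator[OF point_valuation[OF dw(1)]])
    have "w' g = (False, True)"
      using crisp[OF g(1)] g d PiE_mem[OF point_valuation[OF dw(2)] g(1)] by (auto simp: dm_square_carrier)
    with g d eq[of "Star (gen g)"] gen_trms[OF g(1)] sem_gen[OF g(1)] show False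
      by (cases "w g") auto
  qed
  have c: "c = c'"
    using kind[of c v c' v'] kind[of c' v' c v] p eq crisp unfolding \<iota> by metis
  have "v g = v' g" if g: "g \<in> ?V" for g
  proof (rule ccontr)
    assume ne: "v g \<noteq> v' g"
    then have mid: "v g \<notin> diag" "v' g \<notin> diag" using crisp[OF g] by auto
    show False
    proof (cases c)
      case False
      then show False
        using PiE_mem[OF v g] PiE_mem[OF v' g] mid ne c by (auto simp: dm_square_carrier)
    next
      case True
      \<comment> \<open>If \<open>v\<close> and \<open>v'\<close> differ at one generator, they differ by the swap everywhere.\<close>
      have "v' h = prod.swap (v h)" if h: "h \<in> ?V" for h
        using crisp[OF h] mid ne eq[of "Meet (gen g) (gen h)"] gen_trms[OF g] gen_trms[OF h]
          sem_gen[OF g] sem_gen[OF h]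
        by (cases "v g"; cases "v' g"; cases "v h"; cases "v' h") (auto simp: \<iota>)
      then have "v' = swap_val n k v"
        using v' by (intro extensionalityI[of _ ?V]) (auto simp: swap_val_def PiE_iff)
      moreover have "v \<in> R" "v' \<in> R"
        using p True c by (auto simp: points_def \<iota>)
      ultimately show False using R_disj by blast
    qed
  qed
  then have "v = v'"
    using v v' by (intro extensionalityI[of _ ?V]) (auto simp: PiE_iff)
  with c \<iota> show ?thesis by simp
qed

text \<open>The term \<open>\<sim> x \<sqinter> x\<star>\<close> takes the value \<open>1\<close> where \<open>x\<close> vanishes and \<open>0\<close> elsewhere, in both simple
  algebras.\<close>

lemma separating_term:
  assumes "\<iota> \<in> points" "\<iota>' \<in> points" "\<iota> \<noteq> \<iota>'"
  obtains s where "s \<in> trms n" "sem n k \<iota> s 0 = (True, True)" "sem n k \<iota>' s 0 = (False, False)"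
proof -
  obtain x where x: "x \<in> trms n"
    and ne: "sem n k \<iota> x 0 = (False, False) \<longleftrightarrow> sem n k \<iota>' x 0 \<noteq> (False, False)"
    using points_eqI[OF assms(1,2)] assms(3) by blast
  let ?e = "Meet (Neg x) (Star x)"
  have e: "sem n k \<kappa> ?e 0 = (sem n k \<kappa> x 0 = (False, False), sem n k \<kappa> x 0 = (False, False))"
    if "\<kappa> \<in> points" for \<kappa>
  proof -
    have "sem n k \<kappa> x 0 \<in> carrier (dm_square (fst \<kappa>))"
      using sem_carrier[OF k point_valuation, of "fst \<kappa>" "snd \<kappa>"] that by simp
    then show ?thesis
      by (cases "sem n k \<kappa> x 0"; cases "fst \<kappa>") (auto simp: dm_square_carrier)
  qed
  show thesis
  proof (cases "sem n k \<iota> x 0 = (False, False)")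
    case True
    then show thesis
      using that[of ?e] e[OF assms(1)] e[OF assms(2)] x ne by (simp del: sem_simps(2))
  next
    case False
    then show thesis
      using that[of "Neg ?e"] e[OF assms(1)] e[OF assms(2)] x ne by (simp del: sem_simps(2))
  qed
qed

lemma isolating_term:
  assumes \<iota>: "\<iota> \<in> points"
  obtains s where "s \<in> trms n" "sem n k \<iota> s 0 = (True, True)"
    "\<And>\<kappa>. \<kappa> \<in> points \<Longrightarrow> \<kappa> \<noteq> \<iota> \<Longrightarrow> sem n k \<kappa> s 0 = (False, False)"
proof -
  have "\<exists>s\<in>trms n. sem n k \<iota> s 0 = (True, True) \<and> (\<forall>\<kappa>\<in>S. sem n k \<kappa> s 0 = (False, False))"
    if "finite S" "S \<subseteq> points - {\<iota>}" for S
    using that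
  proof (induction S rule: finite_induct)
    case empty
    then show ?case by (intro bexI[of _ One]) auto
  next
    case (insert \<kappa> S)
    then obtain s where s: "s \<in> trms n" "sem n k \<iota> s 0 = (True, True)"
      "\<forall>\<kappa>\<in>S. sem n k \<kappa> s 0 = (False, False)" by auto
    obtain s' where "s' \<in> trms n" "sem n k \<iota> s' 0 = (True, True)" "sem n k \<kappa> s' 0 = (False, False)"
      using separating_term[of \<iota> \<kappa>] insert.prems \<iota> by blast
    with s show ?case by (intro bexI[of _ "Meet s' s"]) auto
  qed
  from this[of "points - {\<iota>}"] finite_points that show thesis by auto
qed

text \<open>A value other than \<open>0\<close> and \<open>1\<close> is attained by a generator with a nondiagonal value or, in
  \<open>T\<^sub>4\<close>, by the \<open>star\<close> of this generator.\<close>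

lemma term_with_value:
  assumes \<iota>: "\<iota> \<in> points" and a: "a \<in> factor \<iota>"
  obtains w where "w \<in> trms n" "sem n k \<iota> w 0 = a"
proof (cases "a \<in> diag")
  case True
  then show thesis using that[of Zero] that[of One] by auto
next
  case False
  then have nd: "snd \<iota> \<notin> vals n k diag" and ac: "a \<in> carrier (dm_square (fst \<iota>))"
    using a by (auto simp: factor_def split: if_splits)
  have v: "snd \<iota> \<in> vals n k (carrier (dm_square (fst \<iota>)))"
    using point_valuation \<iota> by simp
  obtain g where g: "g \<in> {..<n} \<times> {..<k}" "snd \<iota> g \<notin> diag"
    using nondiag_generator[OF v nd] .
  have "a = snd \<iota> g \<or> fst \<iota> \<and> a = (\<not> fst (snd \<iota> g), \<not> snd (snd \<iota> g))"
    using ac False g PiE_mem[OF v g(1)]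
    by (cases a; cases "snd \<iota> g"; cases "fst \<iota>") (auto simp: dm_square_carrier)
  then show thesis
    using that[of "gen g"] that[of "Star (gen g)"] gen_trms[OF g(1)] sem_gen[OF g(1), of \<iota>] by auto
qed

text \<open>The join, over all points, of a term with the prescribed value cut down by a term that is \<open>1\<close>
  at that point and \<open>0\<close> at all others.\<close>

lemma interpolating_term:
  assumes G: "\<And>\<iota>. \<iota> \<in> points \<Longrightarrow> G \<iota> \<in> factor \<iota>"
  obtains x where "x \<in> trms n" "\<And>\<iota>. \<iota> \<in> points \<Longrightarrow> sem n k \<iota> x 0 = G \<iota>"
proof -
  have "\<exists>x\<in>trms n. \<forall>\<kappa>\<in>points. sem n k \<kappa> x 0 = (if \<kappa> \<in> S then G \<kappa> else (False, False))"
    if "finite S" "S \<subseteq> points" for S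
    using that
  proof (induction S rule: finite_induct)
    case empty
    then show ?case by (intro bexI[of _ Zero]) auto
  next
    case (insert \<iota> S)
    then obtain x where x: "x \<in> trms n"
      "\<forall>\<kappa>\<in>points. sem n k \<kappa> x 0 = (if \<kappa> \<in> S then G \<kappa> else (False, False))" by auto
    have \<iota>: "\<iota> \<in> points" using insert.prems by simp
    obtain s where s: "s \<in> trms n" "sem n k \<iota> s 0 = (True, True)"
      "\<And>\<kappa>. \<kappa> \<in> points \<Longrightarrow> \<kappa> \<noteq> \<iota> \<Longrightarrow> sem n k \<kappa> s 0 = (False, False)"
      using isolating_term[OF \<iota>] by blast
    obtain w where w: "w \<in> trms n" "sem n k \<iota> w 0 = G \<iota>"
      using term_with_value[OF \<iota> G[OF \<iota>]] by blast
    have "sem n k \<kappa> (Join (Meet s w) x) 0 = (if \<kappa> \<in> insert \<iota> S then G \<kappa> else (False, False))"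
      if "\<kappa> \<in> points" for \<kappa>
      using that x(2) s w insert.hyps by (cases "\<kappa> = \<iota>") auto
    with s w x show ?case by (intro bexI[of _ "Join (Meet s w) x"]) auto
  qed
  from this[of points] finite_points that show thesis by auto
qed

theorem free_Ck_bij_betw_product:
  "\<exists>h. bij_betw h (carrier (free_Ck k n)) (Pi\<^sub>E points factor)"
proof -
  let ?\<Psi> = "\<lambda>x. \<lambda>\<iota>\<in>points. sem n k \<iota> x 0"
  have "?\<Psi> ` trms n = Pi\<^sub>E points factor"
  proof
    show "?\<Psi> ` trms n \<subseteq> Pi\<^sub>E points factor"
      using sem_in_factor by auto
    show "Pi\<^sub>E points factor \<subseteq> ?\<Psi> ` trms n"
    proof
      fix G assume G: "G \<in> Pi\<^sub>E points factor"
      then obtain x where x: "x \<in> trms n" "\<And>\<iota>. \<iota> \<in> points \<Longrightarrow> sem n k \<iota> x 0 = G \<iota>"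
        using interpolating_term[of G] by (auto simp: PiE_iff)
      then have "?\<Psi> x = G"
        using G by (intro extensionalityI[of _ points]) (auto simp: PiE_iff)
      with x show "G \<in> ?\<Psi> ` trms n" by blast
    qed
  qed
  moreover have "cls k n x = cls k n y \<longleftrightarrow> ?\<Psi> x = ?\<Psi> y" if "x \<in> trms n" "y \<in> trms n" for x y
  proof -
    have "?\<Psi> x = ?\<Psi> y \<longleftrightarrow> (\<forall>\<iota>\<in>points. sem n k \<iota> x 0 = sem n k \<iota> y 0)"
    proof
      assume eq: "?\<Psi> x = ?\<Psi> y"
      show "\<forall>\<iota>\<in>points. sem n k \<iota> x 0 = sem n k \<iota> y 0"
      proof
        fix \<iota> assume "\<iota> \<in> points"
        then show "sem n k \<iota> x 0 = sem n k \<iota> y 0"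
          using fun_cong[OF eq, of \<iota>] by simp
      qed
    next
      assume "\<forall>\<iota>\<in>points. sem n k \<iota> x 0 = sem n k \<iota> y 0"
      then show "?\<Psi> x = ?\<Psi> y" by (intro restrict_ext) blast
    qed
    then show ?thesis
      unfolding cls_eq_iff[OF that] Ck_eq_iff_points[OF that] by (rule HOL.sym)
  qed
  ultimately show ?thesis
    using bij_betw_image_same_kernel[of "trms n" "cls k n" ?\<Psi>] by (simp add: carrier_free_Ck)
qed

lemma inj_on_swap_val: "inj_on (swap_val n k) (vals n k S)"
proof (rule inj_onI)
  fix v w assume "v \<in> vals n k S" "w \<in> vals n k S" "swap_val n k v = swap_val n k w"
  then show "v = w"
    by (intro extensionalityI[of _ "{..<n} \<times> {..<k}"])
      (auto simp: PiE_iff swap_val_def fun_eq_iff restrict_def prod_eq_iff split: if_splits)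
qed

lemma card_vals: "card (vals n k S) = card S ^ (n * k)"
  by (simp add: card_PiE card_cartesian_product)

lemma card_square: "card (UNIV :: (bool \<times> bool) set) = 4"
  by (simp flip: UNIV_Times_UNIV add: card_cartesian_product)

lemma card_R: "2 * card R = 4 ^ (n * k) - 2 ^ (n * k)"
proof -
  have finR: "finite R" using R_sub by (rule finite_subset) (simp add: finite_vals)
  have "card (swap_val n k ` R) = card R"
    using R_sub by (intro card_image inj_on_subset[OF inj_on_swap_val[of UNIV]]) auto
  then have "2 * card R = card (R \<union> swap_val n k ` R)"
    using finR R_disj by (simp add: card_Un_disjoint)
  also have "\<dots> = card (vals n k UNIV) - card (vals n k diag)"
    unfolding R_cover by (intro card_Diff_subset finite_vals PiE_mono) auto
  finally show ?thesis
    by (simp add: card_vals card_square numeral_2_eq_2)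
qed

lemma card_product:
  "card (Pi\<^sub>E points factor) = 2 ^ 2 ^ (n * k) * 3 ^ (3 ^ (n * k) - 2 ^ (n * k)) * 4 ^ card R"
proof -
  let ?C = "vals n k (carrier (dm_square False))" and ?D = "vals n k diag"
  have DC: "?D \<subseteq> ?C" by (rule PiE_mono) (auto simp: dm_square_carrier)
  have finR: "finite R" using R_sub by (rule finite_subset) (simp add: finite_vals)
  let ?f = "\<lambda>\<iota>. card (factor \<iota>)"
  have "points = Pair False ` ?D \<union> (Pair False ` (?C - ?D) \<union> Pair True ` R)"
    using DC by (auto simp: points_def)
  then have "prod ?f points =
      prod ?f (Pair False ` ?D \<union> (Pair False ` (?C - ?D) \<union> Pair True ` R))"
    by (rule arg_cong)
  also have "\<dots> = prod ?f (Pair False ` ?D) *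
      (prod ?f (Pair False ` (?C - ?D)) * prod ?f (Pair True ` R))"
    using finite_vals finR by (subst prod.union_disjoint; auto simp: prod.union_disjoint)+
  finally have "prod ?f points = prod ?f (Pair False ` ?D) *
      (prod ?f (Pair False ` (?C - ?D)) * prod ?f (Pair True ` R))" .
  moreover have "(\<Prod>\<iota>\<in>Pair False ` ?D. card (factor \<iota>)) = 2 ^ 2 ^ (n * k)"
    by (simp add: prod.reindex inj_on_def factor_def card_vals numeral_2_eq_2)
  moreover have "(\<Prod>\<iota>\<in>Pair False ` (?C - ?D). card (factor \<iota>)) = 3 ^ (3 ^ (n * k) - 2 ^ (n * k))"
  proof -
    have "card (?C - ?D) = 3 ^ (n * k) - 2 ^ (n * k)"
      using card_Diff_subset[OF finite_vals DC]
      by (simp add: card_vals dm_square_carrier numeral_2_eq_2 numeral_3_eq_3)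
    then show ?thesis
      by (simp add: prod.reindex inj_on_def factor_def dm_square_carrier numeral_3_eq_3)
  qed
  moreover have "(\<Prod>\<iota>\<in>Pair True ` R. card (factor \<iota>)) = 4 ^ card R"
  proof -
    have "card (factor (True, v)) = 4" if "v \<in> R" for v
      using that R_sub by (auto simp: factor_def dm_square_carrier card_square)
    then show ?thesis
      by (simp add: prod.reindex inj_on_def)
  qed
  ultimately show ?thesis
    using card_PiE[OF finite_points, of factor] by simp
qed

end

theorem card_free_Ck:
  assumes k: "k \<ge> 1"
  shows "finite (carrier (free_Ck k n))" (is ?fin)
    and "card (carrier (free_Ck k n)) =
      2 ^ 2 ^ (n * k) * 3 ^ (3 ^ (n * k) - 2 ^ (n * k)) * 4 ^ ((4 ^ (n * k) - 2 ^ (n * k)) div 2)"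
      (is ?card)
proof -
  let ?X = "vals n k UNIV - vals n k diag"
  have "swap_val n k v \<in> ?X \<and> swap_val n k (swap_val n k v) = v \<and> swap_val n k v \<noteq> v"
    if v: "v \<in> ?X" for v
  proof -
    obtain g where g: "g \<in> {..<n} \<times> {..<k}" "v g \<notin> diag"
      using v unfolding PiE_iff by blast
    have "swap_val n k v g \<notin> diag" "swap_val n k v g \<noteq> v g"
      using g by (cases "v g"; auto simp: swap_val_def)+
    moreover have "swap_val n k (swap_val n k v) = v"
      using v by (auto simp: swap_val_def fun_eq_iff PiE_iff extensional_def)
    moreover have "swap_val n k v \<in> vals n k UNIV"
      by (auto simp: swap_val_def)
    ultimately show ?thesis
      using g(1) by (metis DiffI PiE_mem)
  qed
  then obtain R where "R \<subseteq> ?X" "R \<inter> swap_val n k ` R = {}" "R \<union> swap_val n k ` R = ?X"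
    by (rule involution_transversal)
  then interpret point_system n k R
    using k by unfold_locales
  obtain h where h: "bij_betw h (carrier (free_Ck k n)) (Pi\<^sub>E points factor)"
    using free_Ck_bij_betw_product by blast
  have "finite (Pi\<^sub>E points factor)"
    using finite_points by (intro finite_PiE) (auto intro: finite_subset[OF subset_UNIV])
  with bij_betw_finite[OF h] show ?fin by simp
  have "card R = (4 ^ (n * k) - 2 ^ (n * k)) div 2"
    using card_R by simp
  with bij_betw_same_card[OF h] card_product show ?card by simp
qed

section \<open>Inclusion-exclusion over maximal divisors\<close>

text \<open>Moebius inversion in its weakest form: the equation for \<open>m\<close> determines \<open>g m\<close> from the values
  of \<open>g\<close> at the proper divisors of \<open>m\<close>.\<close>

lemma divisor_sum_exists:
  fixes f :: "nat \<Rightarrow> 'a::ab_group_add"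
  obtains g where "\<And>m. m > 0 \<Longrightarrow> f m = (\<Sum>e | e dvd m. g e)"
proof -
  define G where "G g m = f m - (\<Sum>e | e dvd m \<and> e < m. g e)" for g m
  define g where "g = wfrec less_than G"
  have "g m = f m - (\<Sum>e | e dvd m \<and> e < m. g e)" for m
    unfolding g_def by (subst wfrec, simp) (auto simp: G_def cut_def intro!: sum.cong)
  moreover have "{e. e dvd m} = insert m {e. e dvd m \<and> e < m}" if "m > 0" for m :: nat
    using that by (auto simp: le_neq_implies_less dvd_imp_le)
  ultimately have "f m = (\<Sum>e | e dvd m. g e)" if "m > 0" for m
    using that by (simp add: algebra_simps)
  then show thesis by (rule that)
qed

lemma proper_divisor_below_maximal:
  assumes "d > 0" "e dvd d" "e \<noteq> d"
  shows "\<exists>m\<in>maximal_divisors d. e dvd m"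
proof -
  let ?P = "\<lambda>m. m dvd d \<and> m \<noteq> d \<and> e dvd m"
  have bd: "m \<le> d" if "?P m" for m
    using that assms(1) by (auto dest: dvd_imp_le)
  define m where "m = Greatest ?P"
  have m: "?P m"
    unfolding m_def using assms bd by (intro GreatestI_nat[of ?P e d]) auto
  have max: "y \<le> m" if "?P y" for y
    unfolding m_def using that bd by (intro Greatest_le_nat[of ?P y d]) auto
  have "m \<in> maximal_divisors d"
    unfolding maximal_divisors_def
  proof (intro CollectI conjI allI impI)
    fix y assume y: "y dvd d \<and> y \<noteq> d \<and> m dvd y"
    then have "y > 0" using assms(1) by (auto intro: Nat.gr0I)
    with y have "m \<le> y" by (auto intro: dvd_imp_le)
    moreover have "y \<le> m" using y m by (intro max) (auto intro: dvd_trans)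
    ultimately show "y = m" by simp
  qed (use m in auto)
  with m show ?thesis by blast
qed

lemma finite_maximal_divisors: "d > 0 \<Longrightarrow> finite (maximal_divisors d)"
  by (rule finite_subset[OF _ finite_divisors_nat[of d]]) (auto simp: maximal_divisors_def)

text \<open>The index set \<open>X\<close> stands for the maximal divisors or for the pairs of them, with \<open>\<phi> z\<close> the
  set of divisors that \<open>z\<close> consists of; this covers both kinds of alternating sums in the
  exponents. In terms of \<open>g\<close>, the value \<open>f (Gcd M)\<close> is the measure of the set of common divisors of
  \<open>M\<close>, so inclusion-exclusion gives the measure of the divisors common to some \<open>\<phi> z\<close>. As every
  proper divisor of \<open>d\<close> lies below a maximal one, and each singleton of a maximal divisor occurs as
  some \<open>\<phi> z\<close>, these are all proper divisors of \<open>d\<close>.\<close>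

lemma inclusion_exclusion_maximal_divisors:
  fixes f g :: "nat \<Rightarrow> real"
  assumes fg: "\<And>m. m > 0 \<Longrightarrow> f m = (\<Sum>e | e dvd m. g e)"
    and d: "d > 0" and X: "finite X"
    and \<phi>: "\<And>z. z \<in> X \<Longrightarrow> \<phi> z \<noteq> {} \<and> \<phi> z \<subseteq> maximal_divisors d"
    and diag: "\<And>m. m \<in> maximal_divisors d \<Longrightarrow> \<exists>z\<in>X. \<phi> z = {m}"
  shows "(\<Sum>Z | Z \<noteq> {} \<and> Z \<subseteq> X. (- 1) ^ (card Z - 1) * f (Gcd (\<Union>(\<phi> ` Z)))) = f d - g d"
proof -
  define D where "D z = {e. \<forall>m\<in>\<phi> z. e dvd m}" for z
  have pos: "m > 0" if "m \<in> maximal_divisors d" for m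
    using that d by (auto simp: maximal_divisors_def intro: Nat.gr0I)
  have Dsub: "D z \<subseteq> {e. e dvd d \<and> e \<noteq> d}" if z: "z \<in> X" for z
  proof
    fix e assume e: "e \<in> D z"
    obtain m where m: "m \<in> \<phi> z" "m \<in> maximal_divisors d" using \<phi>[OF z] by blast
    with e have em: "e dvd m" by (auto simp: D_def)
    have md: "m dvd d" "m \<noteq> d" using m by (auto simp: maximal_divisors_def)
    with em show "e \<in> {e. e dvd d \<and> e \<noteq> d}"
      by (auto intro: dvd_trans dest: dvd_antisym)
  qed
  interpret Incl_Excl finite "sum g"
    by unfold_locales (auto simp: disjnt_def sum.union_disjoint)
  have "(\<Sum>Z | Z \<noteq> {} \<and> Z \<subseteq> X. (- 1) ^ (card Z - 1) * f (Gcd (\<Union>(\<phi> ` Z))))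
      = (\<Sum>Z | Z \<subseteq> X \<and> Z \<noteq> {}. (- 1) ^ (card Z + 1) * sum g (\<Inter>(D ` Z)))"
  proof (rule sum.cong, blast, clarify)
    fix Z assume Z: "Z \<subseteq> X" "Z \<noteq> {}"
    have "finite Z" using Z X by (auto intro: finite_subset)
    with Z have "card Z > 0" by (simp add: card_gt_0_iff)
    then have sgn: "(- 1 :: real) ^ (card Z - 1) = (- 1) ^ (card Z + 1)"
      by (cases "card Z") simp_all
    obtain z m where "z \<in> Z" "m \<in> \<phi> z" "m > 0"
      using Z \<phi> pos by blast
    then have "Gcd (\<Union>(\<phi> ` Z)) > 0"
      using Gcd_dvd[of m "\<Union>(\<phi> ` Z)"] by (metis UN_I dvd_0_left_iff gr0I neq0_conv)
    moreover have "\<Inter>(D ` Z) = {e. e dvd Gcd (\<Union>(\<phi> ` Z))}"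
      by (auto simp: D_def dvd_Gcd_iff)
    ultimately show "(- 1) ^ (card Z - 1) * f (Gcd (\<Union>(\<phi> ` Z))) =
        (- 1) ^ (card Z + 1) * sum g (\<Inter>(D ` Z))"
      using fg sgn by simp
  qed
  also have "\<dots> = sum g (\<Union>(D ` X))"
    by (rule restricted_indexed[symmetric, OF X])
      (rule finite_subset[OF Dsub], use d in auto)
  also have "\<Union>(D ` X) = {e. e dvd d \<and> e \<noteq> d}"
  proof
    show "{e. e dvd d \<and> e \<noteq> d} \<subseteq> \<Union>(D ` X)"
    proof clarify
      fix e assume "e dvd d" "e \<noteq> d"
      then obtain m where m: "m \<in> maximal_divisors d" "e dvd m"
        using proper_divisor_below_maximal d by blast
      with diag obtain z where "z \<in> X" "\<phi> z = {m}" by blast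
      with m show "e \<in> \<Union>(D ` X)" by (auto simp: D_def)
    qed
  qed (use Dsub in blast)
  also have "sum g {e. e dvd d \<and> e \<noteq> d} = f d - g d"
  proof -
    have "{e. e dvd d} = insert d {e. e dvd d \<and> e \<noteq> d}" by auto
    moreover have "finite {e. e dvd d \<and> e \<noteq> d}" using d by simp
    ultimately show ?thesis using fg[OF d] by simp
  qed
  finally show ?thesis .
qed

lemma inclusion_exclusion_single:
  fixes f g :: "nat \<Rightarrow> real"
  assumes "\<And>m. m > 0 \<Longrightarrow> f m = (\<Sum>e | e dvd m. g e)" "d > 0"
  shows "(\<Sum>Z | Z \<noteq> {} \<and> Z \<subseteq> maximal_divisors d. (- 1) ^ (card Z - 1) * f (Gcd Z)) = f d - g d"
  using inclusion_exclusion_maximal_divisors[OF assms finite_maximal_divisors[OF assms(2)],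
      of "\<lambda>m. {m}"]
  by simp

lemma inclusion_exclusion_pairs:
  fixes f g :: "nat \<Rightarrow> real"
  assumes "\<And>m. m > 0 \<Longrightarrow> f m = (\<Sum>e | e dvd m. g e)" "d > 0"
  shows "(\<Sum>H | H \<noteq> {} \<and> H \<subseteq> maximal_divisors d \<times> maximal_divisors d.
            (- 1) ^ (card H - 1) * f (Gcd (Domain H \<union> Range H))) = f d - g d"
proof -
  have "Domain H \<union> Range H = (\<Union>z\<in>H. {fst z, snd z})" for H :: "(nat \<times> nat) set"
    by force
  then show ?thesis
    using inclusion_exclusion_maximal_divisors[OF assms, of "maximal_divisors d \<times> maximal_divisors d"
        "\<lambda>z. {fst z, snd z}"] finite_maximal_divisors[OF assms(2)]
    by force
qed

lemma sum_alphas: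
  assumes "k > 0"
  shows "(\<Sum>d | d dvd k. real d * alpha2 n d) = 2 ^ (n * k)"
    and "(\<Sum>d | d dvd k. real d * alpha3 n d) = 3 ^ (n * k) - 2 ^ (n * k)"
    and "(\<Sum>d | d dvd k. real d * alpha4 n d) = (4 ^ (n * k) - 2 ^ (n * k)) / 2"
proof -
  define f where "f q m = (q ^ m) ^ n" for q :: real and m :: nat
  have "\<exists>g. \<forall>m>0. f q m = (\<Sum>e | e dvd m. g e)" for q
    using divisor_sum_exists[of "f q"] by metis
  then obtain g where fg: "\<And>q m. m > 0 \<Longrightarrow> f q m = (\<Sum>e | e dvd m. g q e)"
    by metis
  have fk: "f q k = q ^ (n * k)" for q
    by (simp add: f_def mult.commute flip: power_mult)
  have pos: "d > 0" if "d dvd k" for d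
    using that assms by (auto intro: Nat.gr0I)
  note single = inclusion_exclusion_single[OF fg, unfolded f_def]
    and pairs = inclusion_exclusion_pairs[OF fg, unfolded f_def]
  have "real d * alpha2 n d = g 2 d" if "d dvd k" for d
    using pos[OF that] by (simp del: One_nat_def add: alpha2_def single)
  then show "(\<Sum>d | d dvd k. real d * alpha2 n d) = 2 ^ (n * k)"
    by (simp flip: fk add: fg[OF assms])
  have "real d * alpha3 n d = g 3 d - g 2 d" if "d dvd k" for d
    using pos[OF that] by (simp del: One_nat_def add: alpha3_def single pairs)
  then show "(\<Sum>d | d dvd k. real d * alpha3 n d) = 3 ^ (n * k) - 2 ^ (n * k)"
    by (simp flip: fk add: fg[OF assms] sum_subtractf)
  have "real d * alpha4 n d = (g 4 d - g 2 d) / 2" if "d dvd k" for d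
    using pos[OF that] by (simp del: One_nat_def add: alpha4_def single pairs)
  then have "(\<Sum>d | d dvd k. real d * alpha4 n d) = (\<Sum>d | d dvd k. (g 4 d - g 2 d) / 2)"
    by (rule sum.cong[OF HOL.refl]) simp
  also have "\<dots> = (f 4 k - f 2 k) / 2"
    by (simp add: fg[OF assms] sum_subtractf flip: sum_divide_distrib)
  finally show "(\<Sum>d | d dvd k. real d * alpha4 n d) = (4 ^ (n * k) - 2 ^ (n * k)) / 2"
    by (simp add: fk)
qed

lemma prod_power_powr:
  fixes a :: "nat \<Rightarrow> real" and q :: real
  assumes "q > 0"
  shows "(\<Prod>d\<in>S. (q ^ d) powr a d) = q powr (\<Sum>d\<in>S. real d * a d)"
proof -
  have "(q ^ d) powr a d = q powr (real d * a d)" for d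
    using assms by (simp add: powr_powr flip: powr_realpow)
  then show ?thesis
    using assms by (induction S rule: infinite_finite_induct) (auto simp: powr_add)
qed

section \<open>The cardinality formula\<close>

theorem theorem4p1:
  fixes k n :: nat
  assumes "k \<ge> 1" and "n \<ge> 1"
  shows "finite (carrier (free_Ck k n)) \<and>
    real (card (carrier (free_Ck k n))) =
      (\<Prod>d | d dvd k. (2 ^ d) powr alpha2 n d) *
      (\<Prod>d | d dvd k. (3 ^ d) powr alpha3 n d) *
      (\<Prod>d | d dvd k. (4 ^ d) powr alpha4 n d)"
proof -
  define N where "N = n * k"
  have k: "k > 0" using assms(1) by simp
  note alphas = sum_alphas[OF k, of n, folded N_def]
  have "(\<Prod>d | d dvd k. (2 ^ d) powr alpha2 n d) = 2 powr real (2 ^ N)"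
    by (simp add: prod_power_powr alphas)
  then have p2: "(\<Prod>d | d dvd k. (2 ^ d) powr alpha2 n d) = 2 ^ 2 ^ N"
    by (simp only: powr_realpow zero_less_numeral)
  have "(2 :: nat) ^ N \<le> 3 ^ N" by (rule power_mono) simp_all
  then have "(\<Prod>d | d dvd k. (3 ^ d) powr alpha3 n d) = 3 powr real (3 ^ N - 2 ^ N)"
    by (simp add: prod_power_powr alphas of_nat_diff)
  then have p3: "(\<Prod>d | d dvd k. (3 ^ d) powr alpha3 n d) = 3 ^ (3 ^ N - 2 ^ N)"
    by (simp only: powr_realpow zero_less_numeral)
  have "(2 :: nat) ^ N \<le> 4 ^ N" by (rule power_mono) simp_all
  \<comment> \<open>Evenness makes the truncating division agree with the real one.\<close>
  moreover have "even ((4 :: nat) ^ N - 2 ^ N)" by (cases N) simp_all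
  ultimately have "(\<Prod>d | d dvd k. (4 ^ d) powr alpha4 n d) = 4 powr real ((4 ^ N - 2 ^ N) div 2)"
    by (simp add: prod_power_powr alphas of_nat_diff real_of_nat_div)
  then have p4: "(\<Prod>d | d dvd k. (4 ^ d) powr alpha4 n d) = 4 ^ ((4 ^ N - 2 ^ N) div 2)"
    by (simp only: powr_realpow zero_less_numeral)
  show ?thesis
    unfolding p2 p3 p4
    using card_free_Ck[OF assms(1), of n, folded N_def] by simp
qed

end
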